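(* Let $q\in(-1,1)$, let $X^{(q)}=\{X^{(q)}_t\}_{t\in\mathbb{R}}$ be the $q$-Ornstein--Uhlenbeck process, let $x_-=-\frac{2}{\sqrt{1-q}}$ be the left boundary point of its state space, and for $\epsilon>0$ put $$\widetilde Y^{(\epsilon)}_t:=\frac{X^{(q)}_{\epsilon t}-X^{(q)}_0}{\epsilon^2},\qquad t\ge0.$$ Then, under the law $\mathbb{P}(\cdot\mid X^{(q)}_0=x_-)$, as $\epsilon\downarrow0$, the finite-dimensional distributions of $$\{\widetilde Y^{(\epsilon)}_t\}_{t\ge0}$$ converge weakly to those of $$\frac{4}{\sqrt{1-q}}\left\{\mathbb{Z}^{(1/2)}_t-\frac{t^2}{4}\right\}_{t\ge0},$$ where $\mathbb{Z}^{(1/2)}$ is the $1/2$-stable Biane process.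
   Context: Notation: $(a;q)_\infty=\prod_{k=0}^\infty(1-aq^k)$ and $(q)_\infty=\prod_{k=1}^\infty(1-q^k)$ (with $q^0=1$, also for $q=0$). The $q$-Ornstein--Uhlenbeck process $X^{(q)}=\{X^{(q)}_t\}_{t\in\mathbb{R}}$, $q\in(-1,1)$, is the stationary Markov process with càdlàg trajectories and state space $[-2/\sqrt{1-q},2/\sqrt{1-q}]$, whose marginal probability density is $$p(x)=\frac{\sqrt{1-q}\,(q)_\infty}{2\pi}\sqrt{4-(1-q)x^2}\prod_{k=1}^\infty\left[(1+q^k)^2-(1-q)x^2q^k\right],$$ and whose transition probability density from $x$ at time $s$ to $y$ at time $t>s$ is, for $x,y\in[-2/\sqrt{1-q},2/\sqrt{1-q}]$, $$p_{s,t}(x,y)=(e^{-2(t-s)};q)_\infty\prod_{k=0}^\infty\frac{1}{\varphi_{q,k}(t-s,x,y)}\cdot p(y),$$ where $$\varphi_{q,k}(\delta,x,y)=(1-e^{-2\delta}q^{2k})^2-(1-q)e^{-\delta}q^k(1+e^{-2\delta}q^{2k})xy+(1-q)e^{-2\delta}q^{2k}(x^2+y^2).$$ $\mathbb{P}(\cdot\mid X_0^{(q)}=x)$ denotes the law of the Markov process $\{X^{(q)}_t\}_{t\ge0}$ started at $x$ at time $0$ with these transition densities (the endpoints $x=\pm2/\sqrt{1-q}$ are allowed). The $1/2$-stable Biane process $\mathbb{Z}^{(1/2)}=\{\mathbb{Z}^{(1/2)}_t\}_{t\ge0}$ is the Markov process starting from $0$ at time $0$, with support $[t^2/4,\infty)$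 at time $t$, and with transition probability density $$f^{(1/2)}_{t_1,t_2}(y_1,y_2)=\frac{(t_2-t_1)\sqrt{4y_2-t_2^2}}{2\pi\left[(y_2-y_1)^2-(t_2-t_1)(t_1y_2-t_2y_1)\right]},\quad 0\le t_1<t_2<\infty,\ y_1>\frac{t_1^2}{4},\ y_2>\frac{t_2^2}{4};$$ its marginal law at time $t>0$ has density $\frac{t\sqrt{4x-t^2}}{2\pi x^2}$ on $(t^2/4,\infty)$ (the same formula with $t_1=0$, $y_1=0$). *)

theory Defs
  imports "HOL-Probability.Probability"
begin

section \<open>Markov processes with transition densities, indexed by nonnegative times\<close>

definition natural_filtration :: "'a measure \<Rightarrow> (real \<Rightarrow> 'a \<Rightarrow> real) \<Rightarrow> real \<Rightarrow> 'a measure" where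
  "natural_filtration M X s =
     vimage_algebra (space M) (\<lambda>\<omega>. \<lambda>u\<in>{0..s}. X u \<omega>) (\<Pi>\<^sub>M u\<in>{0..s}. borel)"

text \<open>
  \<open>S t\<close> is the state space at time \<open>t\<close>, and \<open>f s t x y\<close> is the density at \<open>y\<close>, with respect to
  Lebesgue measure, of the transition probability from \<open>x\<close> at time \<open>s\<close> to time \<open>t\<close>.
\<close>

definition markov_process ::
  "'a measure \<Rightarrow> real \<Rightarrow> (real \<Rightarrow> real set) \<Rightarrow> (real \<Rightarrow> real \<Rightarrow> real \<Rightarrow> real \<Rightarrow> real) \<Rightarrow>
     (real \<Rightarrow> 'a \<Rightarrow> real) \<Rightarrow> bool" where
  "markov_process M x0 S f X \<longleftrightarrow>
     prob_space M \<and>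
     (\<forall>t\<ge>0. X t \<in> borel_measurable M) \<and>
     (AE \<omega> in M. X 0 \<omega> = x0) \<and>
     (\<forall>t\<ge>0. AE \<omega> in M. X t \<omega> \<in> S t) \<and>
     (\<forall>s t. 0 \<le> s \<longrightarrow> s < t \<longrightarrow>
        (\<forall>B\<in>sets borel. AE \<omega> in M.
           real_cond_exp M (natural_filtration M X s) (\<lambda>\<omega>'. indicator B (X t \<omega>')) \<omega> =
             (LINT y:B|lborel. f s t (X s \<omega>) y)))"

definition cadlag :: "(real \<Rightarrow> real) \<Rightarrow> bool" where
  "cadlag x \<longleftrightarrow>
     (\<forall>t\<ge>0. (x \<longlongrightarrow> x t) (at_right t)) \<and> (\<forall>t>0. \<exists>l. (x \<longlongrightarrow> l) (at_left t))"


section \<open>The \<open>q\<close>-Ornstein--Uhlenbeck process\<close>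

definition q_pochhammer :: "real \<Rightarrow> real \<Rightarrow> real" where
  "q_pochhammer a q = (\<Prod>k. 1 - a * q ^ k)"

definition qOU_states :: "real \<Rightarrow> real set" where
  "qOU_states q = {- 2 / sqrt (1 - q) .. 2 / sqrt (1 - q)}"

text \<open>
  The products over \<open>k \<ge> 1\<close> are written with \<open>Suc k\<close>; in particular \<open>q_pochhammer q q\<close> is
  the product of \<open>1 - q ^ k\<close> over \<open>k \<ge> 1\<close>. The densities are \<open>0\<close> outside the state space; this
  has to be spelled out, since \<open>sqrt\<close> is negative at negative arguments.
\<close>

definition qOU_density :: "real \<Rightarrow> real \<Rightarrow> real" where
  "qOU_density q x =
     (if x \<in> qOU_states q
      then sqrt (1 - q) * q_pochhammer q q / (2 * pi) * sqrt (4 - (1 - q) * x\<^sup>2) *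
           (\<Prod>k. (1 + q ^ Suc k)\<^sup>2 - (1 - q) * x\<^sup>2 * q ^ Suc k)
      else 0)"

definition qOU_phi :: "real \<Rightarrow> nat \<Rightarrow> real \<Rightarrow> real \<Rightarrow> real \<Rightarrow> real" where
  "qOU_phi q k \<delta> x y =
     (1 - exp (- 2 * \<delta>) * q ^ (2 * k))\<^sup>2
     - (1 - q) * exp (- \<delta>) * q ^ k * (1 + exp (- 2 * \<delta>) * q ^ (2 * k)) * x * y
     + (1 - q) * exp (- 2 * \<delta>) * q ^ (2 * k) * (x\<^sup>2 + y\<^sup>2)"

definition qOU_transition :: "real \<Rightarrow> real \<Rightarrow> real \<Rightarrow> real \<Rightarrow> real \<Rightarrow> real" where
  "qOU_transition q s t x y =
     q_pochhammer (exp (- 2 * (t - s))) q * (\<Prod>k. 1 / qOU_phi q k (t - s) x y) * qOU_density q y"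

text \<open>
  \<open>qOU_process q M x X\<close> says that \<open>X\<close>, on the probability space \<open>M\<close>, has the law of the
  \<open>q\<close>-Ornstein--Uhlenbeck process conditioned to be at \<open>x\<close> at time \<open>0\<close>, that is, of the Markov
  process started at \<open>x\<close> with the transition densities above.
\<close>

definition qOU_process :: "real \<Rightarrow> 'a measure \<Rightarrow> real \<Rightarrow> (real \<Rightarrow> 'a \<Rightarrow> real) \<Rightarrow> bool" where
  "qOU_process q M x X \<longleftrightarrow>
     markov_process M x (\<lambda>_. qOU_states q) (qOU_transition q) X \<and>
     (\<forall>\<omega>\<in>space M. cadlag (\<lambda>t. X t \<omega>))"


section \<open>The \<open>1/2\<close>-stable Biane process\<close>

text \<open>
  The formula is meant for \<open>y1 > t1\<^sup>2 / 4\<close>, and for \<open>t1 = y1 = 0\<close>, where it gives the marginal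
  density at time \<open>t2\<close>. Its values at other \<open>y1\<close> are irrelevant: at a time \<open>t1 > 0\<close> the process
  exceeds \<open>t1\<^sup>2 / 4\<close> almost surely.
\<close>

definition biane_transition :: "real \<Rightarrow> real \<Rightarrow> real \<Rightarrow> real \<Rightarrow> real" where
  "biane_transition t1 t2 y1 y2 =
     (if y2 > t2\<^sup>2 / 4
      then (t2 - t1) * sqrt (4 * y2 - t2\<^sup>2) /
           (2 * pi * ((y2 - y1)\<^sup>2 - (t2 - t1) * (t1 * y2 - t2 * y1)))
      else 0)"

definition biane_process :: "'a measure \<Rightarrow> (real \<Rightarrow> 'a \<Rightarrow> real) \<Rightarrow> bool" where
  "biane_process M Z \<longleftrightarrow> markov_process M 0 (\<lambda>t. {t\<^sup>2 / 4 ..}) biane_transition Z"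


section \<open>Weak convergence of finite-dimensional distributions\<close>

definition fin_dim_distr ::
  "'a measure \<Rightarrow> (real \<Rightarrow> 'a \<Rightarrow> real) \<Rightarrow> ('n \<Rightarrow> real) \<Rightarrow> (real ^ 'n::finite) measure" where
  "fin_dim_distr M X t = distr M borel (\<lambda>\<omega>. \<chi> i. X (t i) \<omega>)"

definition converges_weakly ::
  "('i \<Rightarrow> 'b::topological_space measure) \<Rightarrow> 'b measure \<Rightarrow> 'i filter \<Rightarrow> bool" where
  "converges_weakly \<mu> \<nu> F \<longleftrightarrow>
     (\<forall>f :: 'b \<Rightarrow> real. continuous_on UNIV f \<longrightarrow> bounded (range f) \<longrightarrow>
        ((\<lambda>i. \<integral>x. f x \<partial>\<mu> i) \<longlongrightarrow> (\<integral>x. f x \<partial>\<nu>)) F)"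

end

theory Submission
  imports Defs "HOL-Real_Asymp.Real_Asymp"
begin

text \<open>
  Everything happens on the level of joint densities. Let \<open>0 < \<sigma>\<^sub>1 < \<dots> < \<sigma>\<^sub>n\<close> be the distinct positive
  times among the \<open>t i\<close>. The Markov property turns the transition densities into a joint density
  of the process at these times, namely their product along the path, and an affine change of
  variables gives the joint density of the rescaled process (\<open>markov_process_distr_affine\<close>). For the
  \<open>q\<close>-Ornstein--Uhlenbeck process started at \<open>x\<^sub>- = - 2 / sqrt (1 - q)\<close> one step has the density
  \<open>\<epsilon>\<^sup>2 p(\<epsilon> s, \<epsilon> t; x\<^sub>- + \<epsilon>\<^sup>2 u, x\<^sub>- + \<epsilon>\<^sup>2 v)\<close>, and for the limit process, where the shift \<open>t\<^sup>2 / 4\<close> is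
  subtracted and the scale is \<open>c = sqrt (1 - q) / 4\<close>, it is
  \<open>c f(s, t; s\<^sup>2 / 4 + c u, t\<^sup>2 / 4 + c v)\<close>.

  The analytic core is that the first density converges to the second one at every point
  (\<open>qOU_kernel_edge_limit\<close>). At the edge \<open>x = y = x\<^sub>-\<close> and at time lag \<open>0\<close>, every factor with index
  \<open>k \<ge> 1\<close> of the infinite products has a positive limit, a power of \<open>1 - q\<^sup>k\<close>; these limits combine
  to powers of \<open>(q;q)\<^sub>\<infinity>\<close> that cancel. What survives comes from three factors only. With
  \<open>\<tau> = t - s\<close>, the factor \<open>1 - exp (- 2 \<epsilon> \<tau>)\<close> is of order \<open>\<epsilon>\<close>, the square root that vanishes at the
  edge is of order \<open>\<epsilon>\<close>, and the factor with \<open>k = 0\<close> in the denominator is of order \<open>\<epsilon>\<^sup>4\<close>, with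
  limiting coefficient \<open>\<tau>\<^sup>4 + (1 - q) (u - v)\<^sup>2 + 2 sqrt (1 - q) \<tau>\<^sup>2 (u + v)\<close>. Together with the
  Jacobian \<open>\<epsilon>\<^sup>2\<close> all powers of \<open>\<epsilon>\<close> cancel, and the coefficient is \<open>16\<close> times the bracket in the
  denominator of the Biane transition density.

  Pointwise convergence of densities suffices: both families consist of probability densities,
  because they are the densities of laws of given processes, so Scheffe's lemma yields convergence
  in \<open>L\<^sup>1\<close>, which is stronger than weak convergence (\<open>integral_density_tendsto\<close>).
\<close>

section \<open>Joint densities of a Markov chain\<close>

text \<open>
  The coordinates of the chain are numbered from \<open>1\<close> to \<open>n\<close>, and index \<open>0\<close> stands for the deterministic
  starting point, which is always \<open>0\<close> here.
\<close>

definition chain_density :: "(nat \<Rightarrow> real \<Rightarrow> real \<Rightarrow> real) \<Rightarrow> nat \<Rightarrow> (nat \<Rightarrow> real) \<Rightarrow> real" where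
  "chain_density g n y = (\<Prod>i<n. g i ((y(0 := 0)) i) (y (Suc i)))"

lemma chain_density_measurable:
  assumes "\<And>i. i < n \<Longrightarrow> (\<lambda>(x, y). g i x y) \<in> borel_measurable (borel \<Otimes>\<^sub>M borel)"
  shows "chain_density g n \<in> borel_measurable (\<Pi>\<^sub>M i\<in>{0<..n}. lborel)"
  unfolding chain_density_def
proof (rule borel_measurable_prod)
  fix i assume i: "i \<in> {..<n}"
  have 1: "(\<lambda>y. y (Suc i)) \<in> borel_measurable (\<Pi>\<^sub>M i\<in>{0<..n}. lborel)"
    using measurable_component_singleton[of "Suc i" "{0<..n}" "\<lambda>_. lborel"] i by (simp cong: measurable_cong_sets)
  have 2: "(\<lambda>y. (y(0 := 0)) i) \<in> borel_measurable (\<Pi>\<^sub>M i\<in>{0<..n}. lborel)"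
  proof (cases "i = 0")
    case False
    then show ?thesis
      using measurable_component_singleton[of i "{0<..n}" "\<lambda>_. lborel"] i by (simp cong: measurable_cong_sets)
  qed simp
  show "(\<lambda>y. g i ((y(0 := 0)) i) (y (Suc i))) \<in> borel_measurable (\<Pi>\<^sub>M i\<in>{0<..n}. lborel)"
    using measurable_compose[OF measurable_Pair[OF 2 1] assms[of i]] i by simp
qed

lemma chain_density_nonneg:
  assumes "\<And>i x y. i < n \<Longrightarrow> 0 \<le> g i x y"
  shows "0 \<le> chain_density g n y"
  unfolding chain_density_def using assms by (intro prod_nonneg) auto

text \<open>
  It is enough to compare both measures on boxes. The box condition on the last coordinate is
  integrated out by the one-step formula, and what remains is the expectation of a function of
  the previous coordinates, which the induction hypothesis expresses through their density.
\<close>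

lemma distr_chain:
  fixes M :: "'a measure" and W :: "nat \<Rightarrow> 'a \<Rightarrow> real"
  assumes M: "prob_space M"
    and W: "\<And>i. i \<le> n \<Longrightarrow> W i \<in> borel_measurable M"
    and W0: "AE \<omega> in M. W 0 \<omega> = 0"
    and g_meas: "\<And>i. i < n \<Longrightarrow> (\<lambda>(x, y). g i x y) \<in> borel_measurable (borel \<Otimes>\<^sub>M borel)"
    and g_nonneg: "\<And>i x y. i < n \<Longrightarrow> 0 \<le> g i x y"
    and step: "\<And>i A B. i < n \<Longrightarrow> (\<And>j. A j \<in> sets borel) \<Longrightarrow> B \<in> sets borel \<Longrightarrow>
      emeasure M {\<omega> \<in> space M. (\<forall>j\<in>{0<..i}. W j \<omega> \<in> A j) \<and> W (Suc i) \<omega> \<in> B} =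
      (\<integral>\<^sup>+\<omega>. indicator {\<omega>. \<forall>j\<in>{0<..i}. W j \<omega> \<in> A j} \<omega> *
         (\<integral>\<^sup>+y. ennreal (g i (W i \<omega>) y) * indicator B y \<partial>lborel) \<partial>M)"
  shows "distr M (\<Pi>\<^sub>M i\<in>{0<..n}. lborel) (\<lambda>\<omega>. \<lambda>i\<in>{0<..n}. W i \<omega>) =
         density (\<Pi>\<^sub>M i\<in>{0<..n}. lborel) (\<lambda>y. ennreal (chain_density g n y))"
  using W g_meas g_nonneg step
proof (induction n)
  case 0
  interpret prob_space M by (rule M)
  show ?case
  proof (rule measure_eqI)
    fix A assume A: "A \<in> sets (distr M (\<Pi>\<^sub>M i\<in>{0<..0}. lborel) (\<lambda>\<omega>. \<lambda>i\<in>{0<..0::nat}. W i \<omega>))"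
    then have "A = {} \<or> A = {\<lambda>_. undefined}"
      by (auto simp: PiM_empty)
    then show "emeasure (distr M (\<Pi>\<^sub>M i\<in>{0<..0}. lborel) (\<lambda>\<omega>. \<lambda>i\<in>{0<..0::nat}. W i \<omega>)) A =
      emeasure (density (\<Pi>\<^sub>M i\<in>{0<..0}. lborel) (\<lambda>y. ennreal (chain_density g 0 y))) A"
      by (auto simp: chain_density_def PiM_empty emeasure_distr emeasure_density emeasure_space_1
          restrict_def nn_integral_count_space_finite)
  qed simp
next
  case (Suc n)
  interpret prob_space M by (rule M)
  interpret L: product_sigma_finite "\<lambda>_::nat. lborel :: real measure"
    by standard
  let ?P = "\<lambda>n. \<Pi>\<^sub>M i\<in>{0<..n::nat}. (lborel :: real measure)"
  let ?W = "\<lambda>n \<omega>. \<lambda>i\<in>{0<..n}. W i \<omega>"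
  have WP: "?W m \<in> measurable M (?P m)" if "m \<le> Suc n" for m
    using Suc.prems(1) that by (intro measurable_restrict) simp
  have IH: "distr M (?P n) (?W n) = density (?P n) (\<lambda>y. ennreal (chain_density g n y))"
    by (rule Suc.IH) (use Suc.prems in auto)
  have cd [measurable]: "chain_density g n \<in> borel_measurable (?P n)"
    "chain_density g (Suc n) \<in> borel_measurable (?P (Suc n))"
    by (intro chain_density_measurable Suc.prems(2); simp)+
  have Ins: "{0<..Suc n} = insert (Suc n) {0<..n}" by auto
  show ?case
  proof (rule measure_eqI_PiM_finite[where I="{0<..Suc n}" and M="\<lambda>_. lborel"
        and A="\<lambda>i::nat. \<Pi>\<^sub>E j\<in>{0<..Suc n}. {-real i..real i}"])
    fix A :: "nat \<Rightarrow> real set"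
    assume "\<And>i. i \<in> {0<..Suc n} \<Longrightarrow> A i \<in> sets lborel"
    \<comment> \<open>The one-step formula needs Borel sets at all indices, so \<open>A\<close> is replaced outside the index set.\<close>
    define C where "C i = (if i \<in> {0<..Suc n} then A i else {})" for i
    have C [measurable]: "C i \<in> sets borel" for i
      using \<open>\<And>i. i \<in> {0<..Suc n} \<Longrightarrow> A i \<in> sets lborel\<close>[of i] by (auto simp: C_def)
    have AC: "Pi\<^sub>E {0<..Suc n} A = Pi\<^sub>E {0<..Suc n} C"
      by (rule PiE_cong) (simp add: C_def)
    define K where "K x = (\<integral>\<^sup>+z. ennreal (g n x z) * indicator (C (Suc n)) z \<partial>lborel)" for x
    note gm = Suc.prems(2)[of n, simplified]
    have K [measurable]: "K \<in> borel_measurable borel"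
      unfolding K_def using gm by measurable
    have Kn: "(\<lambda>y. K ((y(0 := 0)) n)) \<in> borel_measurable (?P n)"
    proof (cases "n = 0")
      case False
      then have "(\<lambda>y. y n) \<in> borel_measurable (?P n)"
        using measurable_component_singleton[of n "{0<..n}" "\<lambda>_. lborel"] by (simp cong: measurable_cong_sets)
      then show ?thesis using False by simp
    qed simp
    have rect [measurable]: "Pi\<^sub>E {0<..m} C \<in> sets (?P m)" for m
      by (rule sets_PiM_I_finite) auto
    have "emeasure (distr M (?P (Suc n)) (?W (Suc n))) (Pi\<^sub>E {0<..Suc n} A) =
        emeasure M {\<omega> \<in> space M. (\<forall>j\<in>{0<..n}. W j \<omega> \<in> C j) \<and> W (Suc n) \<omega> \<in> C (Suc n)}"
      unfolding AC using WP[of "Suc n"]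
      by (subst emeasure_distr) (auto simp: PiE_iff Ins intro!: arg_cong[where f="emeasure M"])
    also have "\<dots> = (\<integral>\<^sup>+\<omega>. indicator {\<omega>. \<forall>j\<in>{0<..n}. W j \<omega> \<in> C j} \<omega> * K (W n \<omega>) \<partial>M)"
      unfolding K_def by (rule Suc.prems(4)) (auto simp: C)
    also have "\<dots> = (\<integral>\<^sup>+\<omega>. indicator (Pi\<^sub>E {0<..n} C) (?W n \<omega>) * K (((?W n \<omega>)(0 := 0)) n) \<partial>M)"
      using W0 by (intro nn_integral_cong_AE) (auto simp: indicator_def PiE_iff elim!: eventually_mono)
    also have "\<dots> = (\<integral>\<^sup>+y. indicator (Pi\<^sub>E {0<..n} C) y * K ((y(0 := 0)) n) \<partial>distr M (?P n) (?W n))"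
      using WP[of n] Kn by (subst nn_integral_distr) auto
    also have "\<dots> = (\<integral>\<^sup>+y. ennreal (chain_density g n y) * (indicator (Pi\<^sub>E {0<..n} C) y * K ((y(0 := 0)) n)) \<partial>?P n)"
      unfolding IH using Kn by (subst nn_integral_density) auto
    also have "\<dots> = (\<integral>\<^sup>+y. (\<integral>\<^sup>+z. ennreal (chain_density g (Suc n) (y(Suc n := z))) *
        indicator (Pi\<^sub>E {0<..Suc n} C) (y(Suc n := z)) \<partial>lborel) \<partial>?P n)"
    proof (rule nn_integral_cong)
      fix y assume "y \<in> space (?P n)"
      then have y: "y \<in> extensional {0<..n}" by (simp add: space_PiM PiE_iff)
      have ind: "indicator (Pi\<^sub>E {0<..Suc n} C) (y(Suc n := z)) =
          (indicator (Pi\<^sub>E {0<..n} C) y * indicator (C (Suc n)) z :: ennreal)" for z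
        using y by (auto simp: indicator_def PiE_iff extensional_def Ins)
      have cds: "chain_density g (Suc n) (y(Suc n := z)) = chain_density g n y * g n ((y(0 := 0)) n) z" for z
        unfolding chain_density_def
        by (auto intro!: prod.cong)
      have nn: "0 \<le> chain_density g n y" "\<And>x z. 0 \<le> g n x z"
        using Suc.prems(3) by (auto intro!: chain_density_nonneg)
      have gm1: "(\<lambda>z. g n x z) \<in> borel_measurable borel" for x
        using measurable_compose[OF measurable_Pair1' gm, of x] by simp
      show "ennreal (chain_density g n y) * (indicator (Pi\<^sub>E {0<..n} C) y * K ((y(0 := 0)) n)) =
        (\<integral>\<^sup>+z. ennreal (chain_density g (Suc n) (y(Suc n := z))) *
        indicator (Pi\<^sub>E {0<..Suc n} C) (y(Suc n := z)) \<partial>lborel)"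
      proof -
        have "(\<integral>\<^sup>+z. ennreal (chain_density g (Suc n) (y(Suc n := z))) *
            indicator (Pi\<^sub>E {0<..Suc n} C) (y(Suc n := z)) \<partial>lborel) =
          (\<integral>\<^sup>+z. (ennreal (chain_density g n y) * indicator (Pi\<^sub>E {0<..n} C) y) *
            (ennreal (g n ((y(0 := 0)) n) z) * indicator (C (Suc n)) z) \<partial>lborel)"
          unfolding ind cds ennreal_mult[OF nn] by (simp add: ac_simps)
        also have "\<dots> = (ennreal (chain_density g n y) * indicator (Pi\<^sub>E {0<..n} C) y) * K ((y(0 := 0)) n)"
          unfolding K_def using gm1[measurable] by (intro nn_integral_cmult) auto
        finally show ?thesis by (simp add: ac_simps)
      qed
    qed
    also have "\<dots> = (\<integral>\<^sup>+y. ennreal (chain_density g (Suc n) y) * indicator (Pi\<^sub>E {0<..Suc n} C) y \<partial>?P (Suc n))"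
      using cd(2) rect[of "Suc n"] unfolding Ins
      by (subst L.product_nn_integral_insert) auto
    also have "\<dots> = emeasure (density (?P (Suc n)) (\<lambda>y. ennreal (chain_density g (Suc n) y))) (Pi\<^sub>E {0<..Suc n} A)"
      unfolding AC by (subst emeasure_density) auto
    finally show "emeasure (distr M (?P (Suc n)) (?W (Suc n))) (Pi\<^sub>E {0<..Suc n} A) =
      emeasure (density (?P (Suc n)) (\<lambda>y. ennreal (chain_density g (Suc n) y))) (Pi\<^sub>E {0<..Suc n} A)" .
  next
    show "range (\<lambda>i::nat. \<Pi>\<^sub>E j\<in>{0<..Suc n}. {-real i..real i}) \<subseteq> prod_algebra {0<..Suc n} (\<lambda>_. lborel)"
      by (auto intro!: prod_algebraI_finite)
    show "(\<Union>i::nat. \<Pi>\<^sub>E j\<in>{0<..Suc n}. {-real i..real i}) = space (?P (Suc n))"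
    proof (intro equalityI subsetI)
      fix y assume "y \<in> space (?P (Suc n))"
      then have y: "y \<in> extensional {0<..Suc n}" by (simp add: space_PiM PiE_iff)
      obtain i :: nat where "(\<Sum>j\<in>{0<..Suc n}. \<bar>y j\<bar>) \<le> real i"
        using real_arch_simple by blast
      moreover have "\<bar>y j\<bar> \<le> (\<Sum>j\<in>{0<..Suc n}. \<bar>y j\<bar>)" if "j \<in> {0<..Suc n}" for j
        using that by (intro member_le_sum) auto
      ultimately have "\<bar>y j\<bar> \<le> real i" if "j \<in> {0<..Suc n}" for j
        using that by (meson order_trans)
      then have "y \<in> (\<Pi>\<^sub>E j\<in>{0<..Suc n}. {-real i..real i})"
        using y by (auto simp: PiE_iff abs_le_iff minus_le_iff)
      then show "y \<in> (\<Union>i::nat. \<Pi>\<^sub>E j\<in>{0<..Suc n}. {-real i..real i})" by blast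
    qed (auto simp: space_PiM)
    show "emeasure (distr M (?P (Suc n)) (?W (Suc n))) (\<Pi>\<^sub>E j\<in>{0<..Suc n}. {-real i..real i}) \<noteq> \<infinity>" for i
      using prob_space_distr[OF WP[of "Suc n"]]
      by (simp add: finite_measure.emeasure_finite prob_space.finite_measure)
  qed simp_all
qed

section \<open>Joint densities of a Markov process\<close>

lemma markov_processD:
  assumes "markov_process M x0 S f X"
  shows "prob_space M"
    and "0 \<le> s \<Longrightarrow> X s \<in> borel_measurable M"
    and "AE \<omega> in M. X 0 \<omega> = x0"
    and "0 \<le> s \<Longrightarrow> AE \<omega> in M. X s \<omega> \<in> S s"
    and "0 \<le> s \<Longrightarrow> s < t \<Longrightarrow> B \<in> sets borel \<Longrightarrow>
      AE \<omega> in M. real_cond_exp M (natural_filtration M X s) (\<lambda>\<omega>'. indicator B (X t \<omega>')) \<omega> =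
        (LINT y:B|lborel. f s t (X s \<omega>) y)"
  using assms by (simp_all add: markov_process_def)

text \<open>
  The Bochner integral of the transition density is \<open>0\<close> where that density fails to be integrable, so
  the defining property does not by itself give an identity of nonnegative integrals. Taking
  \<open>B = UNIV\<close> shows that the integral is \<open>1\<close> almost surely; hence the density is almost surely
  integrable, and the two kinds of integrals agree.
\<close>

lemma markov_process_step:
  fixes X :: "real \<Rightarrow> 'a \<Rightarrow> real"
  assumes mp: "markov_process M x0 S f X" and st: "0 \<le> s" "s < t"
    and A: "A \<in> sets (natural_filtration M X s)" and B: "B \<in> sets borel"
    and nonneg: "\<And>x y. x \<in> S s \<Longrightarrow> 0 \<le> f s t x y"
    and meas: "\<And>x. x \<in> S s \<Longrightarrow> f s t x \<in> borel_measurable borel"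
  shows "emeasure M {\<omega> \<in> A. X t \<omega> \<in> B} =
    (\<integral>\<^sup>+\<omega>. indicator A \<omega> * (\<integral>\<^sup>+y. ennreal (f s t (X s \<omega>) y) * indicator B y \<partial>lborel) \<partial>M)"
proof -
  interpret prob_space M using mp by (simp add: markov_process_def)
  let ?F = "natural_filtration M X s"
  let ?E = "\<lambda>B. real_cond_exp M ?F (\<lambda>\<omega>. indicator B (X t \<omega>))"
  have X [measurable]: "X u \<in> borel_measurable M" if "0 \<le> u" for u
    using mp that by (simp add: markov_process_def)
  have "(\<lambda>\<omega>. \<lambda>u\<in>{0..s}. X u \<omega>) \<in> measurable M (\<Pi>\<^sub>M u\<in>{0..s}. borel)"
    by (intro measurable_restrict X) simp
  then have sub: "subalgebra M ?F"
    unfolding subalgebra_def natural_filtration_def by (simp add: sets_image_in_sets)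
  interpret F: sigma_finite_subalgebra M ?F
  proof (rule sigma_finite_subalgebra.intro[OF sub])
    have "finite_measure (restr_to_subalg M ?F)"
      using finite_measure_restr_to_subalg[OF sub] finite_measure_axioms by blast
    then show "sigma_finite_measure (restr_to_subalg M ?F)"
      by (simp add: finite_measure_def)
  qed
  have AM [measurable]: "A \<in> sets M"
    using A sub by (auto simp: subalgebra_def)
  have Xt [measurable]: "X t \<in> borel_measurable M" using X[of t] st by simp
  have int: "integrable M (\<lambda>\<omega>. indicator B (X t \<omega>) :: real)" if "B \<in> sets borel" for B
    using that by (intro integrable_const_bound[where B=1]) (auto simp: indicator_def)
  have cond: "AE \<omega> in M. ?E B \<omega> = (LINT y:B|lborel. f s t (X s \<omega>) y)" if "B \<in> sets borel" for B
    using mp st that by (simp add: markov_process_def)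
  have state: "AE \<omega> in M. X s \<omega> \<in> S s"
    using mp st by (simp add: markov_process_def)
  have "AE \<omega> in M. ?E UNIV \<omega> = 1"
    using F.real_cond_exp_F_meas[of "\<lambda>_. 1"] by simp
  then have eq: "AE \<omega> in M. ennreal (?E B \<omega>) = (\<integral>\<^sup>+y. ennreal (f s t (X s \<omega>) y) * indicator B y \<partial>lborel)"
    using cond[OF B] cond[OF sets.top, simplified] state
  proof eventually_elim
    case (elim \<omega>)
    then have "integrable lborel (f s t (X s \<omega>))"
      using not_integrable_integral_eq[of lborel "f s t (X s \<omega>)"] by (auto simp: set_lebesgue_integral_def)
    then have "integrable lborel (\<lambda>y. indicator B y * f s t (X s \<omega>) y)"
      using B integrable_mult_indicator[of B lborel "f s t (X s \<omega>)"] by simp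
    then have "(\<integral>\<^sup>+y. ennreal (indicator B y * f s t (X s \<omega>) y) \<partial>lborel) = ennreal (?E B \<omega>)"
      using elim nonneg[of "X s \<omega>"] by (subst nn_integral_eq_integral) (auto simp: set_lebesgue_integral_def)
    moreover have "ennreal (indicator B y * f s t (X s \<omega>) y) = ennreal (f s t (X s \<omega>) y) * indicator B y" for y
      by (auto simp: indicator_def)
    ultimately show ?case by simp
  qed
  have pos: "AE \<omega> in M. 0 \<le> ?E B \<omega>"
    using int[OF B] by (intro F.real_cond_exp_pos) auto
  have intE: "integrable M (\<lambda>\<omega>. indicator A \<omega> * ?E B \<omega>)"
    using integrable_mult_indicator[OF AM F.real_cond_exp_int(1)[OF int[OF B]]] by simp
  have AB: "{\<omega> \<in> A. X t \<omega> \<in> B} \<in> sets M"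
  proof -
    have "{\<omega> \<in> A. X t \<omega> \<in> B} = A \<inter> (X t -` B \<inter> space M)"
      using sets.sets_into_space[OF AM] by auto
    then show ?thesis using B by (simp add: measurable_sets[OF Xt])
  qed
  have "emeasure M {\<omega> \<in> A. X t \<omega> \<in> B} = ennreal (\<integral>\<omega>. indicator {\<omega> \<in> A. X t \<omega> \<in> B} \<omega> \<partial>M)"
    using AB by (simp add: emeasure_eq_measure)
  also have "(\<integral>\<omega>. indicator {\<omega> \<in> A. X t \<omega> \<in> B} \<omega> \<partial>M) = (LINT \<omega>:A|M. indicator B (X t \<omega>) :: real)"
    unfolding set_lebesgue_integral_def by (intro Bochner_Integration.integral_cong) (auto simp: indicator_def)
  also have "\<dots> = (\<integral>\<omega>. indicator A \<omega> * ?E B \<omega> \<partial>M)"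
    using F.real_cond_exp_intA[OF int[OF B] A] by (simp add: set_lebesgue_integral_def)
  also have "ennreal \<dots> = (\<integral>\<^sup>+\<omega>. ennreal (indicator A \<omega> * ?E B \<omega>) \<partial>M)"
    using intE pos by (subst nn_integral_eq_integral) (auto elim!: eventually_mono simp: indicator_def)
  also have "\<dots> = (\<integral>\<^sup>+\<omega>. indicator A \<omega> * (\<integral>\<^sup>+y. ennreal (f s t (X s \<omega>) y) * indicator B y \<partial>lborel) \<partial>M)"
    using eq by (intro nn_integral_cong_AE) (auto elim!: eventually_mono simp: indicator_def)
  finally show ?thesis .
qed

lemma measurable_natural_filtration:
  assumes "u \<in> {0..s}"
  shows "X u \<in> borel_measurable (natural_filtration M X s)"
proof -
  have "(\<lambda>\<omega>. \<lambda>u\<in>{0..s}. X u \<omega>) \<in> measurable (natural_filtration M X s) (\<Pi>\<^sub>M u\<in>{0..s}. borel)"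
    unfolding natural_filtration_def by (rule measurable_vimage_algebra1) (auto simp: space_PiM)
  from measurable_compose[OF this measurable_component_singleton[OF assms]] assms
  show ?thesis by simp
qed

text \<open>
  The space variable is centred at \<open>a i\<close> at the \<open>i\<close>-th time and divided by \<open>b\<close>; the factor \<open>b\<close> in the
  new kernel \<open>g\<close> is the Jacobian. The kernel has to agree with the transition density only at points
  of the state space, which leaves the freedom to choose it nonnegative and measurable everywhere.
\<close>

lemma markov_process_distr_affine:
  fixes X :: "real \<Rightarrow> 'a \<Rightarrow> real" and a \<sigma> :: "nat \<Rightarrow> real"
  assumes mp: "markov_process M x0 S f X"
    and \<sigma>: "\<sigma> 0 = 0" "\<And>i. i < n \<Longrightarrow> \<sigma> i < \<sigma> (Suc i)"
    and ab: "a 0 = x0" "0 < b"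
    and g: "\<And>i u v. i < n \<Longrightarrow> a i + b * u \<in> S (\<sigma> i) \<Longrightarrow>
      g i u v = b * f (\<sigma> i) (\<sigma> (Suc i)) (a i + b * u) (a (Suc i) + b * v)"
    and g_meas: "\<And>i. i < n \<Longrightarrow> (\<lambda>(x, y). g i x y) \<in> borel_measurable (borel \<Otimes>\<^sub>M borel)"
    and g_nonneg: "\<And>i x y. i < n \<Longrightarrow> 0 \<le> g i x y"
  shows "distr M (\<Pi>\<^sub>M i\<in>{0<..n}. lborel) (\<lambda>\<omega>. \<lambda>i\<in>{0<..n}. (X (\<sigma> i) \<omega> - a i) / b) =
         density (\<Pi>\<^sub>M i\<in>{0<..n}. lborel) (\<lambda>y. ennreal (chain_density g n y))"
proof (rule distr_chain[OF _ _ _ g_meas g_nonneg])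
  show M: "prob_space M" using mp by (simp add: markov_process_def)
  have \<sigma>_mono: "\<sigma> i \<le> \<sigma> j" if "i \<le> j" "j \<le> n" for i j
    using that by (induction j rule: dec_induct) (auto dest: \<sigma>(2)[OF Suc_le_lessD])
  have \<sigma>_nonneg: "0 \<le> \<sigma> i" if "i \<le> n" for i
    using \<sigma>_mono[of 0 i] that \<sigma>(1) by simp
  show X: "(\<lambda>\<omega>. (X (\<sigma> i) \<omega> - a i) / b) \<in> borel_measurable M" if "i \<le> n" for i
  proof -
    have "X (\<sigma> i) \<in> borel_measurable M"
      using mp \<sigma>_nonneg[OF that] by (simp add: markov_process_def)
    then show ?thesis by measurable
  qed
  have "AE \<omega> in M. X 0 \<omega> = x0" using mp by (simp add: markov_process_def)
  then show "AE \<omega> in M. (X (\<sigma> 0) \<omega> - a 0) / b = 0"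
    by (auto simp: \<sigma> ab elim!: eventually_mono)
  fix i :: nat and A :: "nat \<Rightarrow> real set" and B :: "real set"
  assume i: "i < n" and A: "\<And>j. A j \<in> sets borel" and B [measurable]: "B \<in> sets borel"
  let ?s = "\<sigma> i" and ?t = "\<sigma> (Suc i)"
  let ?H = "{\<omega> \<in> space M. \<forall>j\<in>{0<..i}. (X (\<sigma> j) \<omega> - a j) / b \<in> A j}"
  let ?B = "{x. (x - a (Suc i)) / b \<in> B}"
  have f_eq: "f ?s ?t x y = g i ((x - a i) / b) ((y - a (Suc i)) / b) / b" if "x \<in> S ?s" for x y
    using g[OF i, of "(x - a i) / b" "(y - a (Suc i)) / b"] that ab by simp
  have g1 [measurable]: "(\<lambda>z. g i x z) \<in> borel_measurable borel" for x
    using measurable_compose[OF measurable_Pair1' g_meas[OF i], of x] by simp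
  have f_meas: "f ?s ?t x \<in> borel_measurable borel" if "x \<in> S ?s" for x
  proof -
    have "(\<lambda>y. g i ((x - a i) / b) ((y - a (Suc i)) / b) / b) \<in> borel_measurable borel"
      by measurable
    then show ?thesis using f_eq[OF that] by presburger
  qed
  have H: "?H \<in> sets (natural_filtration M X ?s)"
  proof -
    have "?H = {\<omega> \<in> space (natural_filtration M X ?s). \<forall>j\<in>{0<..i}. X (\<sigma> j) \<omega> \<in> {x. (x - a j) / b \<in> A j}}"
      by (simp add: natural_filtration_def)
    also have "\<dots> \<in> sets (natural_filtration M X ?s)"
    proof (rule sets.sets_Collect_finite_All)
      fix j assume j: "j \<in> {0<..i}"
      have "X (\<sigma> j) \<in> borel_measurable (natural_filtration M X ?s)"
        using j i \<sigma>_mono[of j i] \<sigma>_nonneg[of j] by (intro measurable_natural_filtration) auto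
      moreover have "{x. (x - a j) / b \<in> A j} \<in> sets borel"
        using A[of j] by measurable
      ultimately show "{\<omega> \<in> space (natural_filtration M X ?s). X (\<sigma> j) \<omega> \<in> {x. (x - a j) / b \<in> A j}} \<in>
          sets (natural_filtration M X ?s)"
        by measurable
    qed auto
    finally show ?thesis .
  qed
  have "emeasure M {\<omega> \<in> space M. (\<forall>j\<in>{0<..i}. (X (\<sigma> j) \<omega> - a j) / b \<in> A j) \<and> (X ?t \<omega> - a (Suc i)) / b \<in> B}
    = emeasure M {\<omega> \<in> ?H. X ?t \<omega> \<in> ?B}"
    by (rule arg_cong[where f="emeasure M"]) auto
  also have "\<dots> = (\<integral>\<^sup>+\<omega>. indicator ?H \<omega> * (\<integral>\<^sup>+y. ennreal (f ?s ?t (X ?s \<omega>) y) * indicator ?B y \<partial>lborel) \<partial>M)"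
  proof (rule markov_process_step[OF mp _ _ H _ _ f_meas])
    show "0 \<le> ?s" "?s < ?t" using i \<sigma>_nonneg \<sigma> by auto
    show "?B \<in> sets borel" by measurable
    show "0 \<le> f ?s ?t x y" if "x \<in> S ?s" for x y
      using f_eq[OF that] g_nonneg[OF i] ab by simp
  qed
  also have "\<dots> = (\<integral>\<^sup>+\<omega>. indicator {\<omega>. \<forall>j\<in>{0<..i}. (X (\<sigma> j) \<omega> - a j) / b \<in> A j} \<omega> *
         (\<integral>\<^sup>+y. ennreal (g i ((X (\<sigma> i) \<omega> - a i) / b) y) * indicator B y \<partial>lborel) \<partial>M)"
  proof (rule nn_integral_cong_AE)
    have "AE \<omega> in M. X ?s \<omega> \<in> S ?s"
      using mp i \<sigma>_nonneg by (simp add: markov_process_def)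
    then show "AE \<omega> in M. indicator ?H \<omega> * (\<integral>\<^sup>+y. ennreal (f ?s ?t (X ?s \<omega>) y) * indicator ?B y \<partial>lborel) =
      indicator {\<omega>. \<forall>j\<in>{0<..i}. (X (\<sigma> j) \<omega> - a j) / b \<in> A j} \<omega> *
         (\<integral>\<^sup>+y. ennreal (g i ((X (\<sigma> i) \<omega> - a i) / b) y) * indicator B y \<partial>lborel)"
      using AE_space
    proof eventually_elim
      case (elim \<omega>)
      note [measurable] = f_meas[OF elim(1)]
      have "(\<integral>\<^sup>+y. ennreal (f ?s ?t (X ?s \<omega>) y) * indicator ?B y \<partial>lborel) =
        ennreal b * (\<integral>\<^sup>+y. ennreal (f ?s ?t (X ?s \<omega>) (a (Suc i) + b * y)) * indicator ?B (a (Suc i) + b * y) \<partial>lborel)"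
        using ab by (subst nn_integral_real_affine[where c=b and t="a (Suc i)"]) auto
      also have "\<dots> = (\<integral>\<^sup>+y. ennreal b * (ennreal (f ?s ?t (X ?s \<omega>) (a (Suc i) + b * y)) * indicator ?B (a (Suc i) + b * y)) \<partial>lborel)"
        by (subst nn_integral_cmult) auto
      also have "\<dots> = (\<integral>\<^sup>+y. ennreal (g i ((X (\<sigma> i) \<omega> - a i) / b) y) * indicator B y \<partial>lborel)"
        using ab g_nonneg[OF i]
        by (intro nn_integral_cong) (auto simp: f_eq[OF elim(1)] indicator_def simp flip: ennreal_mult)
      finally show ?case using elim(2) by (simp add: indicator_def)
    qed
  qed
  finally show "emeasure M {\<omega> \<in> space M. (\<forall>j\<in>{0<..i}. (X (\<sigma> j) \<omega> - a j) / b \<in> A j) \<and> (X ?t \<omega> - a (Suc i)) / b \<in> B}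
    = (\<integral>\<^sup>+\<omega>. indicator {\<omega>. \<forall>j\<in>{0<..i}. (X (\<sigma> j) \<omega> - a j) / b \<in> A j} \<omega> *
         (\<integral>\<^sup>+y. ennreal (g i ((X (\<sigma> i) \<omega> - a i) / b) y) * indicator B y \<partial>lborel) \<partial>M)" .
qed

section \<open>Convergence of densities implies convergence of expectations\<close>

text \<open>
  Since all the densities have total mass \<open>1\<close>, Scheffe's lemma upgrades pointwise convergence to
  convergence in \<open>L\<^sup>1\<close>, and the expectations of a function bounded by \<open>C\<close> under two densities differ
  by at most \<open>C\<close> times their \<open>L\<^sup>1\<close> distance.
\<close>

lemma integral_density_tendsto:
  fixes D :: "nat \<Rightarrow> 'a \<Rightarrow> real" and D' h :: "'a \<Rightarrow> real"
  assumes D [measurable]: "\<And>k. D k \<in> borel_measurable L" "D' \<in> borel_measurable L"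
    and nonneg: "\<And>k x. 0 \<le> D k x" "\<And>x. 0 \<le> D' x"
    and prob: "\<And>k. prob_space (density L (\<lambda>x. ennreal (D k x)))" "prob_space (density L (\<lambda>x. ennreal (D' x)))"
    and lim: "\<And>x. (\<lambda>k. D k x) \<longlonglongrightarrow> D' x"
    and h [measurable]: "h \<in> borel_measurable L" and bound: "\<And>x. \<bar>h x\<bar> \<le> C"
  shows "(\<lambda>k. \<integral>x. h x \<partial>density L (\<lambda>x. ennreal (D k x))) \<longlonglongrightarrow> (\<integral>x. h x \<partial>density L (\<lambda>x. ennreal (D' x)))"
proof -
  have one: "(\<integral>\<^sup>+x. ennreal (d x) \<partial>L) = 1"
    if "prob_space (density L (\<lambda>x. ennreal (d x)))" "d \<in> borel_measurable L" for d :: "'a \<Rightarrow> real"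
    using prob_space.emeasure_space_1[OF that(1)] that(2) by (simp add: emeasure_density cong: nn_integral_cong)
  have int: "integrable L d"
    if "prob_space (density L (\<lambda>x. ennreal (d x)))" "d \<in> borel_measurable L" "\<And>x. 0 \<le> d x" for d :: "'a \<Rightarrow> real"
    using one[OF that(1,2)] that(2,3) by (intro integrableI_nonneg) auto
  have L1: "(\<lambda>k. \<integral>\<^sup>+x. norm (D k x - D' x) \<partial>L) \<longlonglongrightarrow> 0"
  proof (rule Scheffe_lemma2)
    show "(\<integral>\<^sup>+x. norm (D k x) \<partial>L) \<le> (\<integral>\<^sup>+x. norm (D' x) \<partial>L)" for k
      using one[OF prob(1) D(1), of k] one[OF prob(2) D(2)] nonneg by simp
  qed (simp_all add: lim int[OF prob(2) D(2) nonneg(2)])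
  have eq: "(\<integral>x. h x \<partial>density L (\<lambda>x. ennreal (d x))) = (\<integral>x. d x * h x \<partial>L)"
    if "d \<in> borel_measurable L" "\<And>x. 0 \<le> d x" for d :: "'a \<Rightarrow> real"
    using that by (subst integral_density) auto
  have inth: "integrable L (\<lambda>x. d x * h x)" if "integrable L d" for d :: "'a \<Rightarrow> real"
  proof (rule Bochner_Integration.integrable_bound[where f="\<lambda>x. C * d x"])
    show "AE x in L. norm (d x * h x) \<le> norm (C * d x)"
    proof (rule AE_I2)
      fix x
      show "norm (d x * h x) \<le> norm (C * d x)"
        using mult_right_mono[of "\<bar>h x\<bar>" "\<bar>C\<bar>" "\<bar>d x\<bar>"] bound[of x] by (simp add: abs_mult mult.commute)
    qed
  qed (use that in simp, use borel_measurable_integrable[OF that] in measurable)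
  have "(\<lambda>k. (\<integral>x. D k x * h x \<partial>L) - (\<integral>x. D' x * h x \<partial>L)) \<longlonglongrightarrow> 0"
  proof (rule Lim_null_comparison)
    have "(\<lambda>k. ennreal C * (\<integral>\<^sup>+x. norm (D k x - D' x) \<partial>L)) \<longlonglongrightarrow> ennreal C * 0"
      by (intro ennreal_tendsto_cmult L1) simp
    then show "(\<lambda>k. enn2real (ennreal C * (\<integral>\<^sup>+x. norm (D k x - D' x) \<partial>L))) \<longlonglongrightarrow> 0"
      by (intro tendsto_enn2real) auto
    show "\<forall>\<^sub>F k in sequentially. norm ((\<integral>x. D k x * h x \<partial>L) - (\<integral>x. D' x * h x \<partial>L))
        \<le> enn2real (ennreal C * (\<integral>\<^sup>+x. norm (D k x - D' x) \<partial>L))"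
    proof (rule always_eventually, rule allI)
      fix k
      have i: "integrable L (D k)" "integrable L D'"
        by (intro int prob D nonneg)+
      then have i': "integrable L (\<lambda>x. C * \<bar>D k x - D' x\<bar>)" by simp
      have C: "0 \<le> C" using bound[of undefined] by linarith
      have "(\<integral>x. D k x * h x \<partial>L) - (\<integral>x. D' x * h x \<partial>L) = (\<integral>x. (D k x - D' x) * h x \<partial>L)"
        unfolding left_diff_distrib
        by (rule Bochner_Integration.integral_diff[symmetric]) (intro inth i)+
      also have "norm \<dots> \<le> (\<integral>x. norm ((D k x - D' x) * h x) \<partial>L)"
        by (rule integral_norm_bound)
      also have "\<dots> \<le> (\<integral>x. C * \<bar>D k x - D' x\<bar> \<partial>L)"
      proof (rule integral_mono)
        show "integrable L (\<lambda>x. norm ((D k x - D' x) * h x))"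
          by (intro integrable_norm inth Bochner_Integration.integrable_diff i)
        show "norm ((D k x - D' x) * h x) \<le> C * \<bar>D k x - D' x\<bar>" for x
          using mult_right_mono[OF bound[of x], of "\<bar>D k x - D' x\<bar>"] by (simp add: abs_mult mult.commute)
      qed (rule i')
      also have "\<dots> = enn2real (\<integral>\<^sup>+x. ennreal (C * \<bar>D k x - D' x\<bar>) \<partial>L)"
        using C by (subst nn_integral_eq_integral[OF i']) auto
      also have "(\<integral>\<^sup>+x. ennreal (C * \<bar>D k x - D' x\<bar>) \<partial>L) = ennreal C * (\<integral>\<^sup>+x. norm (D k x - D' x) \<partial>L)"
        using C by (simp add: ennreal_mult nn_integral_cmult)
      finally show "norm ((\<integral>x. D k x * h x \<partial>L) - (\<integral>x. D' x * h x \<partial>L))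
        \<le> enn2real (ennreal C * (\<integral>\<^sup>+x. norm (D k x - D' x) \<partial>L))" .
    qed
  qed
  then show ?thesis
    unfolding eq[OF D(1) nonneg(1)] eq[OF D(2) nonneg(2)] by (simp add: LIM_zero_iff)
qed

section \<open>Infinite products depending on a parameter\<close>

lemma convergent_prod_dominated:
  fixes a :: "nat \<Rightarrow> real"
  assumes "\<And>k. \<bar>a k - 1\<bar> \<le> B k" "summable B"
  shows "convergent_prod a"
proof (rule abs_convergent_prod_imp_convergent_prod)
  show "abs_convergent_prod a"
    unfolding abs_convergent_prod_conv_summable
    by (rule summable_comparison_test'[OF assms(2)]) (use assms(1) in auto)
qed

text \<open>
  By the Weierstrass M-test the partial products converge uniformly. Their limit is the
  value of the infinite product because no factor vanishes.
\<close>

lemma continuous_on_prodinf: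
  fixes f :: "nat \<Rightarrow> real \<Rightarrow> real"
  assumes K: "compact K" and cont: "\<And>k. continuous_on K (f k)"
    and bound: "\<And>k x. x \<in> K \<Longrightarrow> \<bar>f k x - 1\<bar> \<le> B k" and B: "summable B"
    and nz: "\<And>k x. x \<in> K \<Longrightarrow> f k x \<noteq> 0"
  shows "continuous_on K (\<lambda>x. \<Prod>k. f k x)"
proof -
  have "uniformly_convergent_on K (\<lambda>n x. \<Sum>k<n. \<bar>f k x - 1\<bar>)"
    by (rule Weierstrass_m_test'[OF _ B]) (use bound in auto)
  then have "uniformly_convergent_on K (\<lambda>n x. \<Prod>k<n. 1 + (f k x - 1))"
    using K by (intro uniformly_convergent_on_prod_real continuous_intros cont) auto
  then have lim: "uniform_limit K (\<lambda>n x. \<Prod>k<n. f k x) (\<lambda>x. lim (\<lambda>n. \<Prod>k<n. f k x)) sequentially"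
    by (simp add: uniformly_convergent_uniform_limit_iff)
  have "continuous_on K (\<lambda>x. lim (\<lambda>n. \<Prod>k<n. f k x))"
    by (rule uniform_limit_theorem[OF _ lim]) (auto intro!: always_eventually continuous_intros cont)
  then show ?thesis
  proof (rule continuous_on_eq)
    fix x assume x: "x \<in> K"
    show "lim (\<lambda>n. \<Prod>k<n. f k x) = (\<Prod>k. f k x)"
      using convergent_prod_dominated[of "\<lambda>k. f k x", OF bound[OF x] B] nz[OF x]
      by (simp add: prodinf_eq_lim')
  qed
qed

section \<open>The transition densities of the \<open>q\<close>-Ornstein--Uhlenbeck process\<close>

lemma qOU_states_iff:
  assumes "q < 1"
  shows "x \<in> qOU_states q \<longleftrightarrow> (1 - q) * x\<^sup>2 \<le> 4"
proof -
  have s: "0 < sqrt (1 - q)" using assms by simp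
  have "x \<in> qOU_states q \<longleftrightarrow> \<bar>sqrt (1 - q) * x\<bar> \<le> \<bar>2\<bar>"
    unfolding qOU_states_def using s by (auto simp add: abs_le_iff field_simps)
  also have "\<dots> \<longleftrightarrow> (sqrt (1 - q) * x)\<^sup>2 \<le> 2\<^sup>2"
    by (rule abs_le_square_iff)
  also have "(sqrt (1 - q) * x)\<^sup>2 = (1 - q) * x\<^sup>2"
    using assms by (simp add: power_mult_distrib)
  finally show ?thesis by simp
qed

text \<open>
  Time lag and index enter only through \<open>r = exp (- \<delta>) * q ^ k\<close>, so all estimates can be made in \<open>r\<close>.
\<close>

lemma qOU_phi_eq:
  fixes q \<delta> :: real and k :: nat
  defines "r \<equiv> exp (- \<delta>) * q ^ k"
  shows "qOU_phi q k \<delta> x y =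
    (1 - r\<^sup>2)\<^sup>2 - (1 - q) * r * (1 + r\<^sup>2) * x * y + (1 - q) * r\<^sup>2 * (x\<^sup>2 + y\<^sup>2)"
proof -
  have "exp (- 2 * \<delta>) = (exp (- \<delta>))\<^sup>2"
    by (simp add: power2_eq_square flip: exp_add)
  then have "exp (- 2 * \<delta>) * q ^ (2 * k) = r\<^sup>2"
    by (simp add: r_def power_mult_distrib power_mult mult.commute[of 2 k])
  then show ?thesis
    unfolding qOU_phi_def by (simp add: r_def mult.assoc)
qed

text \<open>
  With \<open>X\<close> and \<open>Y\<close> the points \<open>x\<close> and \<open>y\<close> rescaled to \<open>[- 2, 2]\<close>, completing the square gives
  \<open>4 \<phi> = (2 r X - (1 + r\<^sup>2) Y)\<^sup>2 + (4 - Y\<^sup>2) (1 - r\<^sup>2)\<^sup>2\<close>. Both terms vanish together only if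
  \<open>Y = \<plusminus> 2\<close> and \<open>\<bar>r X\<bar> = 1 + r\<^sup>2\<close>, which is impossible as \<open>\<bar>X\<bar> \<le> 2\<close> and \<open>\<bar>r\<bar> < 1\<close>.
\<close>

lemma qOU_phi_pos:
  assumes q: "q < 1" and r: "\<bar>exp (- \<delta>) * q ^ k\<bar> < 1"
    and x: "x \<in> qOU_states q" and y: "y \<in> qOU_states q"
  shows "0 < qOU_phi q k \<delta> x y"
proof -
  define r where "r = exp (- \<delta>) * q ^ k"
  define X where "X = sqrt (1 - q) * x"
  define Y where "Y = sqrt (1 - q) * y"
  have s: "sqrt (1 - q) * sqrt (1 - q) = 1 - q" using q by simp
  have X: "X\<^sup>2 \<le> 4" and Y: "Y\<^sup>2 \<le> 4"
    using x y q by (simp_all add: qOU_states_iff X_def Y_def power_mult_distrib)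
  have r1: "r\<^sup>2 < 1" using r by (simp add: r_def abs_square_less_1)
  have "4 * qOU_phi q k \<delta> x y =
      4 * (1 - r\<^sup>2)\<^sup>2 - 4 * r * (1 + r\<^sup>2) * (X * Y) + 4 * r\<^sup>2 * (X\<^sup>2 + Y\<^sup>2)"
  proof -
    have "X * Y = (1 - q) * x * y" "X\<^sup>2 + Y\<^sup>2 = (1 - q) * (x\<^sup>2 + y\<^sup>2)"
      using s q by (simp_all add: X_def Y_def power_mult_distrib algebra_simps)
    then show ?thesis
      unfolding qOU_phi_eq r_def[symmetric] by (simp only:) (simp add: algebra_simps)
  qed
  also have "\<dots> = (2 * r * X - (1 + r\<^sup>2) * Y)\<^sup>2 + (4 - Y\<^sup>2) * (1 - r\<^sup>2)\<^sup>2"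
    by algebra
  also have "\<dots> > 0"
  proof (cases "Y\<^sup>2 < 4")
    case True
    then have "0 < (4 - Y\<^sup>2) * (1 - r\<^sup>2)\<^sup>2" using r1 by simp
    then show ?thesis by (simp add: add_nonneg_pos)
  next
    case False
    then have Y4: "Y\<^sup>2 = 4" using Y by simp
    have "2 * r * X \<noteq> (1 + r\<^sup>2) * Y"
    proof
      assume "2 * r * X = (1 + r\<^sup>2) * Y"
      then have "4 * r\<^sup>2 * X\<^sup>2 = (1 + r\<^sup>2)\<^sup>2 * Y\<^sup>2"
        by (metis (no_types, lifting) power_mult_distrib four_x_squared)
      moreover have "r\<^sup>2 * X\<^sup>2 \<le> r\<^sup>2 * 4" using X by (intro mult_left_mono) auto
      ultimately have "(1 + r\<^sup>2)\<^sup>2 * 4 \<le> 4 * (r\<^sup>2 * 4)" using Y4 by simp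
      moreover have "(1 + r\<^sup>2)\<^sup>2 - 4 * r\<^sup>2 = (1 - r\<^sup>2)\<^sup>2" by algebra
      ultimately have "(1 - r\<^sup>2)\<^sup>2 \<le> 0" by linarith
      then show False using r1 by simp
    qed
    then show ?thesis using Y4 by simp
  qed
  finally show ?thesis by simp
qed

text \<open>
  In terms of \<open>r\<close> and of the rescaled points \<open>X\<close> and \<open>Y\<close>, every term of \<open>\<phi> - 1\<close> contains a factor \<open>r\<close>; the
  three terms contribute \<open>2\<close>, \<open>8\<close> and \<open>8\<close> to the constant.
\<close>

lemma qOU_phi_bound:
  assumes q: "q < 1" and r: "\<bar>exp (- \<delta>) * q ^ k\<bar> \<le> 1"
    and x: "x \<in> qOU_states q" and y: "y \<in> qOU_states q"
  shows "\<bar>qOU_phi q k \<delta> x y - 1\<bar> \<le> 18 * \<bar>exp (- \<delta>) * q ^ k\<bar>"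
proof -
  define r where "r = exp (- \<delta>) * q ^ k"
  define X where "X = sqrt (1 - q) * x"
  define Y where "Y = sqrt (1 - q) * y"
  have s: "sqrt (1 - q) * sqrt (1 - q) = 1 - q" using q by simp
  have X: "X\<^sup>2 \<le> 4" and Y: "Y\<^sup>2 \<le> 4"
    using x y q by (simp_all add: qOU_states_iff X_def Y_def power_mult_distrib)
  have "\<bar>X\<bar> \<le> 2" "\<bar>Y\<bar> \<le> 2"
    using X Y abs_le_square_iff[of X 2] abs_le_square_iff[of Y 2] by auto
  then have XY: "\<bar>X * Y\<bar> \<le> 4"
    using mult_mono[of "\<bar>X\<bar>" 2 "\<bar>Y\<bar>" 2] by (simp add: abs_mult)
  have r1: "\<bar>r\<bar> \<le> 1" using r by (simp add: r_def)
  have r2: "r\<^sup>2 \<le> \<bar>r\<bar>" using r1 mult_left_le[of "\<bar>r\<bar>" "\<bar>r\<bar>"] by (simp add: power2_eq_square abs_mult_self_eq)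
  have r2': "0 \<le> r\<^sup>2" "r\<^sup>2 \<le> 1" using r2 r1 by (simp, linarith)
  have eq: "qOU_phi q k \<delta> x y - 1 = r\<^sup>2 * (r\<^sup>2 - 2) + - (r * (1 + r\<^sup>2) * (X * Y)) + r\<^sup>2 * (X\<^sup>2 + Y\<^sup>2)"
  proof -
    have "X * Y = (1 - q) * x * y" "X\<^sup>2 + Y\<^sup>2 = (1 - q) * (x\<^sup>2 + y\<^sup>2)"
      using s q by (simp_all add: X_def Y_def power_mult_distrib algebra_simps)
    then show ?thesis
      unfolding qOU_phi_eq r_def[symmetric] by (simp only:) (simp add: algebra_simps power2_eq_square)
  qed
  have "\<bar>r\<^sup>2 * (r\<^sup>2 - 2)\<bar> \<le> \<bar>r\<bar> * 2"
    unfolding abs_mult using r2 r2' by (intro mult_mono) auto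
  moreover have "\<bar>- (r * (1 + r\<^sup>2) * (X * Y))\<bar> \<le> \<bar>r\<bar> * 2 * 4"
    unfolding abs_mult abs_minus_cancel using r2' XY unfolding abs_mult by (intro mult_mono) auto
  moreover have "\<bar>r\<^sup>2 * (X\<^sup>2 + Y\<^sup>2)\<bar> \<le> \<bar>r\<bar> * 8"
    unfolding abs_mult using r2 r2' X Y by (intro mult_mono) auto
  ultimately show ?thesis unfolding eq r_def[symmetric] by linarith
qed

lemma summable_abs_power:
  fixes q :: real
  assumes "\<bar>q\<bar> < 1"
  shows "summable (\<lambda>k. c * \<bar>q ^ k\<bar>)" "summable (\<lambda>k. c * \<bar>q ^ Suc k\<bar>)"
proof -
  show 1: "summable (\<lambda>k. c * \<bar>q ^ k\<bar>)" for c
    using assms by (auto simp: power_abs intro!: summable_mult summable_geometric)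
  show "summable (\<lambda>k. c * \<bar>q ^ Suc k\<bar>)"
    using 1[of "c * \<bar>q\<bar>"] by (simp add: abs_mult mult.assoc)
qed

lemma abs_exp_power_less_1:
  fixes q :: real
  assumes q: "\<bar>q\<bar> < 1" and "0 \<le> \<delta>" "0 < \<delta> \<or> 0 < k"
  shows "\<bar>exp (- \<delta>) * q ^ k\<bar> < 1"
proof (cases "k = 0")
  case False
  have "\<bar>exp (- \<delta>) * q ^ k\<bar> \<le> 1 * \<bar>q\<bar> ^ k"
    using assms unfolding abs_mult power_abs by (intro mult_right_mono) auto
  also have "\<dots> < 1"
    using False q by (simp add: power_less_one_iff)
  finally show ?thesis .
qed (use assms in auto)

lemma qOU_phi_bound_power:
  assumes q: "\<bar>q\<bar> < 1" and \<delta>: "0 \<le> \<delta>"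
    and x: "x \<in> qOU_states q" and y: "y \<in> qOU_states q"
  shows "\<bar>qOU_phi q k \<delta> x y - 1\<bar> \<le> 18 * \<bar>q ^ k\<bar>"
proof -
  have *: "\<bar>exp (- \<delta>) * q ^ k\<bar> \<le> \<bar>q ^ k\<bar>"
    using \<delta> unfolding abs_mult by (intro mult_left_le_one_le) auto
  have "\<bar>q ^ k\<bar> \<le> 1"
    using q by (simp add: power_abs power_le_one)
  with * show ?thesis
    using qOU_phi_bound[of q \<delta> k x y] q x y by linarith
qed

lemma qOU_phi_product:
  assumes q: "\<bar>q\<bar> < 1" and \<delta>: "0 < \<delta>" and x: "x \<in> qOU_states q" and y: "y \<in> qOU_states q"
  shows "convergent_prod (\<lambda>k. qOU_phi q k \<delta> x y)"
    "convergent_prod (\<lambda>k. 1 / qOU_phi q k \<delta> x y)"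
    "0 < (\<Prod>k. 1 / qOU_phi q k \<delta> x y)"
proof -
  show *: "convergent_prod (\<lambda>k. qOU_phi q k \<delta> x y)"
    using qOU_phi_bound_power[OF q _ x y, of \<delta>] summable_abs_power(1)[OF q, of 18] \<delta>
    by (intro convergent_prod_dominated[where B="\<lambda>k. 18 * \<bar>q ^ k\<bar>"]) auto
  from convergent_prod_inverse[OF this]
  show **: "convergent_prod (\<lambda>k. 1 / qOU_phi q k \<delta> x y)"
    by (simp add: divide_inverse)
  have "0 < qOU_phi q k \<delta> x y" for k
    using abs_exp_power_less_1[OF q] \<delta> q by (intro qOU_phi_pos x y) auto
  then show "0 < (\<Prod>k. 1 / qOU_phi q k \<delta> x y)"
    by (intro less_0_prodinf[OF **]) simp
qed

text \<open>
  With \<open>r = q ^ Suc k\<close> and \<open>Y = (1 - q) * y\<^sup>2\<close> in \<open>[0, 4]\<close>, the factor is at least \<open>(1 - r)\<^sup>2\<close> if \<open>r\<close> is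
  nonnegative and at least \<open>(1 + r)\<^sup>2\<close> otherwise, and it differs from \<open>1\<close> by \<open>r (2 + r - Y)\<close>.
\<close>

lemma qOU_density_factor:
  assumes q: "\<bar>q\<bar> < 1" and y: "y \<in> qOU_states q"
  shows "0 < (1 + q ^ Suc k)\<^sup>2 - (1 - q) * y\<^sup>2 * q ^ Suc k"
    "\<bar>(1 + q ^ Suc k)\<^sup>2 - (1 - q) * y\<^sup>2 * q ^ Suc k - 1\<bar> \<le> 3 * \<bar>q ^ Suc k\<bar>"
proof -
  define r where "r = q ^ Suc k"
  define Y where "Y = (1 - q) * y\<^sup>2"
  have Y: "0 \<le> Y" "Y \<le> 4"
    using y q by (auto simp: Y_def qOU_states_iff)
  have r: "\<bar>r\<bar> < 1"
    using abs_exp_power_less_1[OF q, of 0 "Suc k"] by (simp add: r_def)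
  have "0 < (1 + r)\<^sup>2 - Y * r"
  proof (cases "0 \<le> r")
    case True
    have "Y * r \<le> 4 * r" using True Y by (intro mult_right_mono)
    moreover have "0 < (1 - r)\<^sup>2" using r by simp
    moreover have "(1 - r)\<^sup>2 = (1 + r)\<^sup>2 - 4 * r" by algebra
    ultimately show ?thesis by linarith
  next
    case False
    have "0 < (1 + r)\<^sup>2" using r by simp
    moreover have "Y * r \<le> 0" using False Y by (simp add: mult_nonneg_nonpos)
    ultimately show ?thesis by linarith
  qed
  then show "0 < (1 + q ^ Suc k)\<^sup>2 - (1 - q) * y\<^sup>2 * q ^ Suc k"
    by (simp add: r_def Y_def)
  have "(1 + r)\<^sup>2 - Y * r - 1 = r * (2 + r - Y)" by algebra
  also have "\<bar>\<dots>\<bar> \<le> \<bar>r\<bar> * 3"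
    unfolding abs_mult using r Y by (intro mult_left_mono) auto
  finally show "\<bar>(1 + q ^ Suc k)\<^sup>2 - (1 - q) * y\<^sup>2 * q ^ Suc k - 1\<bar> \<le> 3 * \<bar>q ^ Suc k\<bar>"
    by (simp add: r_def Y_def)
qed

lemma qOU_density_product:
  assumes q: "\<bar>q\<bar> < 1" and y: "y \<in> qOU_states q"
  shows "convergent_prod (\<lambda>k. (1 + q ^ Suc k)\<^sup>2 - (1 - q) * y\<^sup>2 * q ^ Suc k)"
    "0 < (\<Prod>k. (1 + q ^ Suc k)\<^sup>2 - (1 - q) * y\<^sup>2 * q ^ Suc k)"
proof -
  show *: "convergent_prod (\<lambda>k. (1 + q ^ Suc k)\<^sup>2 - (1 - q) * y\<^sup>2 * q ^ Suc k)"
    by (rule convergent_prod_dominated[OF qOU_density_factor(2)[OF q y] summable_abs_power(2)[OF q]])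
  show "0 < (\<Prod>k. (1 + q ^ Suc k)\<^sup>2 - (1 - q) * y\<^sup>2 * q ^ Suc k)"
    by (rule less_0_prodinf[OF * qOU_density_factor(1)[OF q y]])
qed

lemma q_pochhammer_convergent:
  fixes q a :: real
  assumes q: "\<bar>q\<bar> < 1"
  shows "convergent_prod (\<lambda>k. 1 - a * q ^ k)"
  by (rule convergent_prod_dominated[OF _ summable_abs_power(1)[OF q, of "\<bar>a\<bar>"]]) (simp add: abs_mult)

lemma q_pochhammer_pos:
  assumes q: "\<bar>q\<bar> < 1" and a: "\<bar>a\<bar> < 1"
  shows "0 < q_pochhammer a q"
  unfolding q_pochhammer_def
proof (rule less_0_prodinf[OF q_pochhammer_convergent[OF q]])
  fix k
  have "\<bar>a * q ^ k\<bar> \<le> \<bar>a\<bar> * 1"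
    unfolding abs_mult using q by (intro mult_left_mono) (auto simp: power_abs power_le_one)
  then show "0 < 1 - a * q ^ k" using a by linarith
qed

lemma qOU_density_nonneg:
  assumes q: "\<bar>q\<bar> < 1"
  shows "0 \<le> qOU_density q y"
proof (cases "y \<in> qOU_states q")
  case True
  then have "0 \<le> 4 - (1 - q) * y\<^sup>2" using q by (simp add: qOU_states_iff)
  then show ?thesis
    using qOU_density_product(2)[OF q True] q_pochhammer_pos[OF q q] q unfolding qOU_density_def
    by (auto intro!: mult_nonneg_nonneg divide_nonneg_nonneg less_imp_le)
qed (simp add: qOU_density_def)

text \<open>
  Outside the state space the factors \<open>qOU_phi\<close> may vanish or be negative; the kernel is cut off there
  so that it is nonnegative at every point.
\<close>

definition qOU_kernel :: "real \<Rightarrow> real \<Rightarrow> real \<Rightarrow> real \<Rightarrow> real \<Rightarrow> real" where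
  "qOU_kernel q s t x y = (if x \<in> qOU_states q then qOU_transition q s t x y else 0)"

lemma qOU_kernel_nonneg:
  assumes q: "\<bar>q\<bar> < 1" and "s < t"
  shows "0 \<le> qOU_kernel q s t x y"
proof (cases "x \<in> qOU_states q \<and> y \<in> qOU_states q")
  case True
  then have "0 < (\<Prod>k. 1 / qOU_phi q k (t - s) x y)"
    using assms by (intro qOU_phi_product) auto
  moreover have "0 < q_pochhammer (exp (- 2 * (t - s))) q"
    using assms by (intro q_pochhammer_pos) auto
  ultimately show ?thesis
    unfolding qOU_kernel_def qOU_transition_def
    using qOU_density_nonneg[OF q, of y] by simp
qed (auto simp: qOU_kernel_def qOU_transition_def qOU_density_def)

text \<open>
  On the state space the infinite products are pointwise limits of their partial products.
\<close>

lemma qOU_kernel_measurable: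
  assumes q: "\<bar>q\<bar> < 1" and st: "s < t"
  shows "(\<lambda>(x, y). qOU_kernel q s t x y) \<in> borel_measurable (borel \<Otimes>\<^sub>M borel)"
proof -
  have S [measurable]: "qOU_states q \<in> sets borel"
    unfolding qOU_states_def by simp
  have d: "(\<lambda>y. if y \<in> qOU_states q then \<Prod>k. (1 + q ^ Suc k)\<^sup>2 - (1 - q) * y\<^sup>2 * q ^ Suc k else 0)
    \<in> borel_measurable borel"
  proof (rule borel_measurable_LIMSEQ_real)
    show "(\<lambda>n. if y \<in> qOU_states q then \<Prod>k\<le>n. (1 + q ^ Suc k)\<^sup>2 - (1 - q) * y\<^sup>2 * q ^ Suc k else 0)
      \<longlonglongrightarrow> (if y \<in> qOU_states q then \<Prod>k. (1 + q ^ Suc k)\<^sup>2 - (1 - q) * y\<^sup>2 * q ^ Suc k else 0)" for y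
      using convergent_prod_LIMSEQ[OF qOU_density_product(1)[OF q]] by auto
  qed measurable
  have dens [measurable]: "qOU_density q \<in> borel_measurable borel"
  proof -
    have "qOU_density q = (\<lambda>y. sqrt (1 - q) * q_pochhammer q q / (2 * pi) * sqrt (4 - (1 - q) * y\<^sup>2) *
      (if y \<in> qOU_states q then \<Prod>k. (1 + q ^ Suc k)\<^sup>2 - (1 - q) * y\<^sup>2 * q ^ Suc k else 0))"
      by (auto simp: qOU_density_def)
    also have "\<dots> \<in> borel_measurable borel"
      using d by measurable
    finally show ?thesis .
  qed
  have "(\<lambda>z. if fst z \<in> qOU_states q \<and> snd z \<in> qOU_states q
      then \<Prod>k. 1 / qOU_phi q k (t - s) (fst z) (snd z) else 0) \<in> borel_measurable (borel \<Otimes>\<^sub>M borel)"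
  proof (rule borel_measurable_LIMSEQ_real)
    show "(\<lambda>n. if fst z \<in> qOU_states q \<and> snd z \<in> qOU_states q
      then \<Prod>k\<le>n. 1 / qOU_phi q k (t - s) (fst z) (snd z) else 0) \<longlonglongrightarrow>
      (if fst z \<in> qOU_states q \<and> snd z \<in> qOU_states q
      then \<Prod>k. 1 / qOU_phi q k (t - s) (fst z) (snd z) else 0)" for z
      using convergent_prod_LIMSEQ[OF qOU_phi_product(2)[OF q, of "t - s" "fst z" "snd z"]] st by auto
    show "(\<lambda>z. if fst z \<in> qOU_states q \<and> snd z \<in> qOU_states q
      then \<Prod>k\<le>n. 1 / qOU_phi q k (t - s) (fst z) (snd z) else 0) \<in> borel_measurable (borel \<Otimes>\<^sub>M borel)" for n
      unfolding qOU_phi_def by measurable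
  qed
  then have "(\<lambda>z. q_pochhammer (exp (- 2 * (t - s))) q * (if fst z \<in> qOU_states q \<and> snd z \<in> qOU_states q
      then \<Prod>k. 1 / qOU_phi q k (t - s) (fst z) (snd z) else 0) * qOU_density q (snd z))
      \<in> borel_measurable (borel \<Otimes>\<^sub>M borel)"
    by measurable
  also have "(\<lambda>z. q_pochhammer (exp (- 2 * (t - s))) q * (if fst z \<in> qOU_states q \<and> snd z \<in> qOU_states q
      then \<Prod>k. 1 / qOU_phi q k (t - s) (fst z) (snd z) else 0) * qOU_density q (snd z)) =
      (\<lambda>(x, y). qOU_kernel q s t x y)"
    by (auto simp: qOU_kernel_def qOU_transition_def qOU_density_def fun_eq_iff)
  finally show ?thesis .
qed

section \<open>The transition densities of the shifted Biane process\<close>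

text \<open>
  The transition density of \<open>(Z t - t\<^sup>2 / 4) / c\<close>, whose state space is \<open>[0, \<infinity>)\<close> at all times.
\<close>

definition biane_kernel :: "real \<Rightarrow> real \<Rightarrow> real \<Rightarrow> real \<Rightarrow> real \<Rightarrow> real" where
  "biane_kernel c s t u v =
     (if 0 \<le> u then c * biane_transition s t (s\<^sup>2 / 4 + c * u) (t\<^sup>2 / 4 + c * v) else 0)"

text \<open>
  Shifting by \<open>t\<^sup>2 / 4\<close> makes the transition density depend on the two times only through \<open>t - s\<close>, as it
  must for the limit of a stationary process.
\<close>

lemma biane_kernel_eq:
  assumes "0 < \<sigma>" "0 \<le> u" "0 < v"
  shows "biane_kernel (\<sigma> / 4) s t u v = 2 * \<sigma> * (t - s) * sqrt (\<sigma> * v) /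
    (pi * ((t - s) ^ 4 + \<sigma>\<^sup>2 * (u - v)\<^sup>2 + (t - s)\<^sup>2 * (2 * \<sigma> * (u + v))))"
proof -
  have *: "4 * (t\<^sup>2 / 4 + \<sigma> / 4 * v) - t\<^sup>2 = \<sigma> * v" by (simp add: algebra_simps)
  have "(t\<^sup>2 / 4 + \<sigma> / 4 * v - (s\<^sup>2 / 4 + \<sigma> / 4 * u))\<^sup>2 -
      (t - s) * (s * (t\<^sup>2 / 4 + \<sigma> / 4 * v) - t * (s\<^sup>2 / 4 + \<sigma> / 4 * u)) =
    ((t - s) ^ 4 + \<sigma>\<^sup>2 * (u - v)\<^sup>2 + (t - s)\<^sup>2 * (2 * \<sigma> * (u + v))) / 16" (is "?B = ?D / 16")
    by (simp add: field_simps power2_eq_square power4_eq_xxxx)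
  moreover have "t\<^sup>2 / 4 < t\<^sup>2 / 4 + \<sigma> / 4 * v" using assms by simp
  ultimately have "biane_kernel (\<sigma> / 4) s t u v = \<sigma> / 4 * ((t - s) * sqrt (\<sigma> * v) / (2 * pi * (?D / 16)))"
    using assms(2) unfolding biane_kernel_def biane_transition_def * by (simp only: if_True)
  also have "\<dots> = 2 * \<sigma> * (t - s) * sqrt (\<sigma> * v) / (pi * ?D)"
  proof -
    have "\<sigma> / 4 * (n / (2 * pi * (d / 16))) = 2 * \<sigma> * n / (pi * d)" for n d :: real
      by (cases "d = 0") (auto simp: field_simps)
    then show ?thesis by (simp only: mult.assoc)
  qed
  finally show ?thesis .
qed

lemma biane_kernel_eq_0:
  assumes "0 < \<sigma>" "u < 0 \<or> v \<le> 0"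
  shows "biane_kernel (\<sigma> / 4) s t u v = 0"
  using assms by (auto simp: biane_kernel_def biane_transition_def mult_less_0_iff zero_less_mult_iff)

lemma edge_denominator_pos:
  fixes \<sigma> \<tau> u v :: real
  assumes "0 < \<sigma>" "0 < \<tau>" "0 \<le> u" "0 < v"
  shows "0 < \<tau> ^ 4 + \<sigma>\<^sup>2 * (u - v)\<^sup>2 + \<tau>\<^sup>2 * (2 * \<sigma> * (u + v))"
  using assms by (intro add_pos_nonneg mult_nonneg_nonneg) auto

lemma biane_kernel_nonneg:
  assumes "0 < \<sigma>" "s < t"
  shows "0 \<le> biane_kernel (\<sigma> / 4) s t u v"
proof (cases "0 \<le> u \<and> 0 < v")
  case True
  then show ?thesis
    using assms edge_denominator_pos[of \<sigma> "t - s" u v] by (simp add: biane_kernel_eq)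
qed (use assms in \<open>auto simp: biane_kernel_eq_0 not_le not_less\<close>)

lemma biane_kernel_measurable:
  "(\<lambda>(u, v). biane_kernel c s t u v) \<in> borel_measurable (borel \<Otimes>\<^sub>M borel)"
  unfolding biane_kernel_def biane_transition_def by measurable

section \<open>Scaling limit of the transition densities at the left edge\<close>

text \<open>
  The factors with index \<open>0\<close> are the only ones that degenerate as the time lag goes to \<open>0\<close> and both
  points approach the edge.
\<close>

lemma qOU_transition_split_first:
  assumes q: "\<bar>q\<bar> < 1" and st: "s < t" and x: "x \<in> qOU_states q" and y: "y \<in> qOU_states q"
  shows "qOU_transition q s t x y =
    (1 - exp (- 2 * (t - s))) * (\<Prod>k. 1 - exp (- 2 * (t - s)) * q ^ Suc k) *
    (1 / (qOU_phi q 0 (t - s) x y * (\<Prod>k. qOU_phi q (Suc k) (t - s) x y))) * qOU_density q y"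
proof -
  have phi: "0 < qOU_phi q k (t - s) x y" for k
    using abs_exp_power_less_1[OF q, of "t - s" k] st q by (intro qOU_phi_pos x y) auto
  have "(\<Prod>k. 1 / qOU_phi q k (t - s) x y) = 1 / (\<Prod>k. qOU_phi q k (t - s) x y)"
    using prodinf_inverse[OF qOU_phi_product(1)[OF q _ x y, of "t - s"]] st by (simp add: divide_inverse)
  also have "(\<Prod>k. qOU_phi q k (t - s) x y) =
      qOU_phi q 0 (t - s) x y * (\<Prod>k. qOU_phi q (Suc k) (t - s) x y)"
    using prodinf_split_head[OF qOU_phi_product(1)[OF q _ x y, of "t - s"]] phi[of 0] st by simp
  finally have 1: "(\<Prod>k. 1 / qOU_phi q k (t - s) x y) =
      1 / (qOU_phi q 0 (t - s) x y * (\<Prod>k. qOU_phi q (Suc k) (t - s) x y))" .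
  have 2: "q_pochhammer (exp (- 2 * (t - s))) q =
      (1 - exp (- 2 * (t - s))) * (\<Prod>k. 1 - exp (- 2 * (t - s)) * q ^ Suc k)"
    using prodinf_split_head[OF q_pochhammer_convergent[OF q, of "exp (- 2 * (t - s))"]] st
    by (simp add: q_pochhammer_def)
  show ?thesis unfolding qOU_transition_def 1 2 ..
qed

text \<open>
  The left-hand side is the value of \<open>qOU_phi\<close> at time lag \<open>0\<close> with both points at the edge.
\<close>

lemma edge_factor_eq:
  fixes r :: real
  shows "(1 - r\<^sup>2)\<^sup>2 - 4 * r * (1 + r\<^sup>2) + 8 * r\<^sup>2 = (1 - r) ^ 4"
  by algebra

text \<open>
  For small \<open>\<epsilon>\<close> both points lie in the state space, so the distance of the factors from \<open>1\<close> is dominated by a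
  fixed geometric sequence and no factor vanishes; the products are therefore continuous in \<open>\<epsilon>\<close> up to \<open>\<epsilon> = 0\<close>, where
  each of their factors is a power of \<open>1 - q ^ Suc k\<close>.
\<close>

lemma qOU_products_at_edge:
  fixes q \<tau> u v \<sigma> :: real
  assumes q: "\<bar>q\<bar> < 1" and \<tau>: "0 \<le> \<tau>" and u: "0 \<le> u" and v: "0 \<le> v"
  defines "\<sigma> \<equiv> sqrt (1 - q)"
  shows "((\<lambda>\<epsilon>. \<Prod>k. 1 - exp (- 2 * (\<epsilon> * \<tau>)) * q ^ Suc k) \<longlongrightarrow> q_pochhammer q q) (at_right 0)"
    "((\<lambda>\<epsilon>. \<Prod>k. qOU_phi q (Suc k) (\<epsilon> * \<tau>) (- 2 / \<sigma> + \<epsilon>\<^sup>2 * u) (- 2 / \<sigma> + \<epsilon>\<^sup>2 * v))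
      \<longlongrightarrow> q_pochhammer q q ^ 4) (at_right 0)"
    "((\<lambda>\<epsilon>. \<Prod>k. (1 + q ^ Suc k)\<^sup>2 - (1 - q) * (- 2 / \<sigma> + \<epsilon>\<^sup>2 * v)\<^sup>2 * q ^ Suc k)
      \<longlongrightarrow> q_pochhammer q q ^ 2) (at_right 0)"
    "\<forall>\<^sub>F \<epsilon> in at_right 0. - 2 / \<sigma> + \<epsilon>\<^sup>2 * u \<in> qOU_states q \<and> - 2 / \<sigma> + \<epsilon>\<^sup>2 * v \<in> qOU_states q"
proof -
  have \<sigma>: "0 < \<sigma>" "\<sigma>\<^sup>2 = 1 - q" using q by (auto simp: \<sigma>_def)
  \<comment> \<open>\<open>e\<close> is chosen such that \<open>x\<^sub>- + \<epsilon>\<^sup>2 z\<close> stays below the right end \<open>2 / \<sigma>\<close> for \<open>z \<le> w\<close> and \<open>\<epsilon> \<le> e\<close>.\<close>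
  define w where "w = max u v + 1"
  have w: "0 < w" "u \<le> w" "v \<le> w" using u v by (auto simp: w_def)
  define e where "e = sqrt (4 / (\<sigma> * w))"
  have e: "0 < e" "e\<^sup>2 = 4 / (\<sigma> * w)" using \<sigma> w by (auto simp: e_def)
  have states: "- 2 / \<sigma> + \<epsilon>\<^sup>2 * z \<in> qOU_states q" if "0 \<le> z" "z \<le> w" "\<epsilon> \<in> {0..e}" for \<epsilon> z
  proof -
    have "\<epsilon>\<^sup>2 * z \<le> e\<^sup>2 * w"
      using that by (intro mult_mono power_mono) auto
    also have "\<dots> = 4 / \<sigma>" using w e by simp
    finally have "- 2 / \<sigma> + \<epsilon>\<^sup>2 * z \<le> 2 / \<sigma>" by (simp add: field_simps)
    moreover have "0 \<le> \<epsilon>\<^sup>2 * z" using that by simp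
    ultimately show ?thesis unfolding qOU_states_def \<sigma>_def[symmetric] by simp
  qed
  have ev: "\<forall>\<^sub>F \<epsilon> in at_right 0. \<epsilon> \<in> {0<..<e}"
    using eventually_at_right_real[OF e(1)] .
  then show "\<forall>\<^sub>F \<epsilon> in at_right 0. - 2 / \<sigma> + \<epsilon>\<^sup>2 * u \<in> qOU_states q \<and> - 2 / \<sigma> + \<epsilon>\<^sup>2 * v \<in> qOU_states q"
    by eventually_elim (use states u v w in auto)
  have lim: "((\<lambda>\<epsilon>. F \<epsilon>) \<longlongrightarrow> F 0) (at_right 0)" if "continuous_on {0..e} F" for F :: "real \<Rightarrow> real"
    using continuous_on_Icc_at_rightD[OF that e(1)] .
  have P: "(\<Prod>k. 1 - q ^ Suc k) = q_pochhammer q q"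
    by (simp add: q_pochhammer_def)
  have Pc: "convergent_prod (\<lambda>k. 1 - q ^ Suc k)"
    using q_pochhammer_convergent[OF q, of q] by simp
  have edge: "(1 - q) * (- 2 / \<sigma>)\<^sup>2 = 4"
    using \<sigma>(1) by (simp add: power_divide flip: \<sigma>(2))

  have "continuous_on {0..e} (\<lambda>\<epsilon>. \<Prod>k. 1 - exp (- 2 * (\<epsilon> * \<tau>)) * q ^ Suc k)"
  proof (rule continuous_on_prodinf[OF _ _ _ summable_abs_power(2)[OF q, of 1]])
    fix k \<epsilon> assume "\<epsilon> \<in> {0..e}"
    then have *: "\<bar>exp (- 2 * (\<epsilon> * \<tau>)) * q ^ Suc k\<bar> \<le> \<bar>q ^ Suc k\<bar>"
      using \<tau> unfolding abs_mult[of "exp _"] by (intro mult_left_le_one_le) auto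
    then show "\<bar>1 - exp (- 2 * (\<epsilon> * \<tau>)) * q ^ Suc k - 1\<bar> \<le> 1 * \<bar>q ^ Suc k\<bar>" by simp
    show "1 - exp (- 2 * (\<epsilon> * \<tau>)) * q ^ Suc k \<noteq> 0"
      using * abs_exp_power_less_1[OF q, of 0 "Suc k"] by (auto simp del: power_Suc)
  qed (auto intro!: continuous_intros)
  from lim[OF this] show "((\<lambda>\<epsilon>. \<Prod>k. 1 - exp (- 2 * (\<epsilon> * \<tau>)) * q ^ Suc k) \<longlongrightarrow> q_pochhammer q q) (at_right 0)"
    by (simp add: P del: power_Suc)

  have "continuous_on {0..e} (\<lambda>\<epsilon>. \<Prod>k. qOU_phi q (Suc k) (\<epsilon> * \<tau>) (- 2 / \<sigma> + \<epsilon>\<^sup>2 * u) (- 2 / \<sigma> + \<epsilon>\<^sup>2 * v))"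
  proof (rule continuous_on_prodinf[OF _ _ _ summable_abs_power(2)[OF q, of 18]])
    fix k \<epsilon> assume "\<epsilon> \<in> {0..e}"
    then have s: "0 \<le> \<epsilon> * \<tau>" "- 2 / \<sigma> + \<epsilon>\<^sup>2 * u \<in> qOU_states q" "- 2 / \<sigma> + \<epsilon>\<^sup>2 * v \<in> qOU_states q"
      using \<tau> u v w states by auto
    show "\<bar>qOU_phi q (Suc k) (\<epsilon> * \<tau>) (- 2 / \<sigma> + \<epsilon>\<^sup>2 * u) (- 2 / \<sigma> + \<epsilon>\<^sup>2 * v) - 1\<bar> \<le> 18 * \<bar>q ^ Suc k\<bar>"
      by (rule qOU_phi_bound_power[OF q s])
    have "0 < qOU_phi q (Suc k) (\<epsilon> * \<tau>) (- 2 / \<sigma> + \<epsilon>\<^sup>2 * u) (- 2 / \<sigma> + \<epsilon>\<^sup>2 * v)"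
      using abs_exp_power_less_1[OF q s(1), of "Suc k"] q by (intro qOU_phi_pos s(2,3)) auto
    then show "qOU_phi q (Suc k) (\<epsilon> * \<tau>) (- 2 / \<sigma> + \<epsilon>\<^sup>2 * u) (- 2 / \<sigma> + \<epsilon>\<^sup>2 * v) \<noteq> 0" by simp
  qed (auto simp: qOU_phi_def simp del: power_Suc intro!: continuous_intros)
  moreover have "qOU_phi q (Suc k) 0 (- 2 / \<sigma>) (- 2 / \<sigma>) = (1 - q ^ Suc k) ^ 4" for k
  proof -
    have "qOU_phi q (Suc k) 0 (- 2 / \<sigma>) (- 2 / \<sigma>) =
      (1 - (q ^ Suc k)\<^sup>2)\<^sup>2 - q ^ Suc k * (1 + (q ^ Suc k)\<^sup>2) * ((1 - q) * (- 2 / \<sigma>)\<^sup>2)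
        + (q ^ Suc k)\<^sup>2 * (2 * ((1 - q) * (- 2 / \<sigma>)\<^sup>2))"
    proof -
      have "(1 - r\<^sup>2)\<^sup>2 - (1 - q) * r * (1 + r\<^sup>2) * z * z + (1 - q) * r\<^sup>2 * (z\<^sup>2 + z\<^sup>2) =
          (1 - r\<^sup>2)\<^sup>2 - r * (1 + r\<^sup>2) * ((1 - q) * z\<^sup>2) + r\<^sup>2 * (2 * ((1 - q) * z\<^sup>2))" for r z :: real
        by algebra
      then show ?thesis
        unfolding qOU_phi_eq by (simp only: minus_zero exp_zero mult_1_left)
    qed
    also have "\<dots> = (1 - q ^ Suc k) ^ 4"
      unfolding edge edge_factor_eq[symmetric] by algebra
    finally show ?thesis .
  qed
  ultimately show "((\<lambda>\<epsilon>. \<Prod>k. qOU_phi q (Suc k) (\<epsilon> * \<tau>) (- 2 / \<sigma> + \<epsilon>\<^sup>2 * u) (- 2 / \<sigma> + \<epsilon>\<^sup>2 * v))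
      \<longlongrightarrow> q_pochhammer q q ^ 4) (at_right 0)"
    using lim prodinf_power[OF Pc, of 4] by (fastforce simp: P simp del: power_Suc)

  have "continuous_on {0..e} (\<lambda>\<epsilon>. \<Prod>k. (1 + q ^ Suc k)\<^sup>2 - (1 - q) * (- 2 / \<sigma> + \<epsilon>\<^sup>2 * v)\<^sup>2 * q ^ Suc k)"
  proof (rule continuous_on_prodinf[OF _ _ _ summable_abs_power(2)[OF q, of 3]])
    fix k \<epsilon> assume "\<epsilon> \<in> {0..e}"
    then have s: "- 2 / \<sigma> + \<epsilon>\<^sup>2 * v \<in> qOU_states q"
      using v w states by auto
    show "\<bar>(1 + q ^ Suc k)\<^sup>2 - (1 - q) * (- 2 / \<sigma> + \<epsilon>\<^sup>2 * v)\<^sup>2 * q ^ Suc k - 1\<bar> \<le> 3 * \<bar>q ^ Suc k\<bar>"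
      by (rule qOU_density_factor(2)[OF q s])
    show "(1 + q ^ Suc k)\<^sup>2 - (1 - q) * (- 2 / \<sigma> + \<epsilon>\<^sup>2 * v)\<^sup>2 * q ^ Suc k \<noteq> 0"
      using qOU_density_factor(1)[OF q s, of k] by simp
  qed (auto simp del: power_Suc intro!: continuous_intros)
  moreover have "(1 + q ^ Suc k)\<^sup>2 - (1 - q) * (- 2 / \<sigma>)\<^sup>2 * q ^ Suc k = (1 - q ^ Suc k)\<^sup>2" for k
    unfolding edge by algebra
  ultimately show "((\<lambda>\<epsilon>. \<Prod>k. (1 + q ^ Suc k)\<^sup>2 - (1 - q) * (- 2 / \<sigma> + \<epsilon>\<^sup>2 * v)\<^sup>2 * q ^ Suc k)
      \<longlongrightarrow> q_pochhammer q q ^ 2) (at_right 0)"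
    using lim prodinf_power[OF Pc, of 2] by (fastforce simp: P simp del: power_Suc)
qed

text \<open>
  With \<open>E = exp (- \<epsilon> \<tau>)\<close>, the terms of order \<open>\<epsilon>\<^sup>2\<close> cancel at the edge because
  \<open>(1 - E\<^sup>2)\<^sup>2 - 4 E (1 - E)\<^sup>2 = (1 - E)\<^sup>4\<close>, which leaves order \<open>\<epsilon>\<^sup>4\<close>.
\<close>

lemma qOU_phi_0_at_edge:
  fixes q \<tau> u v \<sigma> :: real
  assumes q: "q < 1"
  defines "\<sigma> \<equiv> sqrt (1 - q)"
  shows "((\<lambda>\<epsilon>. qOU_phi q 0 (\<epsilon> * \<tau>) (- 2 / \<sigma> + \<epsilon>\<^sup>2 * u) (- 2 / \<sigma> + \<epsilon>\<^sup>2 * v) / \<epsilon> ^ 4) \<longlongrightarrow>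
    \<tau> ^ 4 + \<sigma>\<^sup>2 * (u - v)\<^sup>2 + \<tau>\<^sup>2 * (2 * \<sigma> * (u + v))) (at_right 0)"
proof -
  have \<sigma>: "0 < \<sigma>" "1 - q = \<sigma>\<^sup>2" using q by (auto simp: \<sigma>_def)
  have quot: "((\<lambda>\<epsilon>. (1 - exp (- (\<epsilon> * \<tau>))) / \<epsilon>) \<longlongrightarrow> \<tau>) (at_right 0)"
    by real_asymp
  have "((\<lambda>\<epsilon>. ((1 - exp (- (\<epsilon> * \<tau>))) / \<epsilon>) ^ 4 + \<sigma>\<^sup>2 * (exp (- (\<epsilon> * \<tau>)))\<^sup>2 * (u - v)\<^sup>2 +
      ((1 - exp (- (\<epsilon> * \<tau>))) / \<epsilon>)\<^sup>2 * exp (- (\<epsilon> * \<tau>)) * (2 * \<sigma> * (u + v) - \<sigma>\<^sup>2 * \<epsilon>\<^sup>2 * u * v)) \<longlongrightarrow>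
      \<tau> ^ 4 + \<sigma>\<^sup>2 * (exp (- (0 * \<tau>)))\<^sup>2 * (u - v)\<^sup>2 +
      \<tau>\<^sup>2 * exp (- (0 * \<tau>)) * (2 * \<sigma> * (u + v) - \<sigma>\<^sup>2 * 0\<^sup>2 * u * v)) (at_right 0)"
    by (intro tendsto_intros quot)
  moreover have "\<forall>\<^sub>F \<epsilon> in at_right 0.
      ((1 - exp (- (\<epsilon> * \<tau>))) / \<epsilon>) ^ 4 + \<sigma>\<^sup>2 * (exp (- (\<epsilon> * \<tau>)))\<^sup>2 * (u - v)\<^sup>2 +
      ((1 - exp (- (\<epsilon> * \<tau>))) / \<epsilon>)\<^sup>2 * exp (- (\<epsilon> * \<tau>)) * (2 * \<sigma> * (u + v) - \<sigma>\<^sup>2 * \<epsilon>\<^sup>2 * u * v) =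
      qOU_phi q 0 (\<epsilon> * \<tau>) (- 2 / \<sigma> + \<epsilon>\<^sup>2 * u) (- 2 / \<sigma> + \<epsilon>\<^sup>2 * v) / \<epsilon> ^ 4"
    using eventually_at_right_less[of 0]
  proof eventually_elim
    case (elim \<epsilon>)
    define E where "E = exp (- (\<epsilon> * \<tau>))"
    define x where "x = - 2 / \<sigma> + \<epsilon>\<^sup>2 * u"
    define y where "y = - 2 / \<sigma> + \<epsilon>\<^sup>2 * v"
    have xy: "\<sigma>\<^sup>2 * x * y = 4 - \<epsilon>\<^sup>2 * (2 * \<sigma> * (u + v) - \<sigma>\<^sup>2 * \<epsilon>\<^sup>2 * u * v)"
      using \<sigma>(1) by (simp add: x_def y_def field_simps power2_eq_square)
    have "qOU_phi q 0 (\<epsilon> * \<tau>) x y =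
        (1 - E\<^sup>2)\<^sup>2 - \<sigma>\<^sup>2 * E * (1 + E\<^sup>2) * x * y + \<sigma>\<^sup>2 * E\<^sup>2 * (x\<^sup>2 + y\<^sup>2)"
      unfolding qOU_phi_eq \<sigma>(2) by (simp add: E_def)
    also have "\<dots> = (1 - E\<^sup>2)\<^sup>2 + \<sigma>\<^sup>2 * E\<^sup>2 * (x - y)\<^sup>2 - E * (1 - E)\<^sup>2 * (\<sigma>\<^sup>2 * x * y)"
      by algebra
    also have "\<dots> = (1 - E) ^ 4 + \<sigma>\<^sup>2 * E\<^sup>2 * (\<epsilon>\<^sup>2 * (u - v))\<^sup>2 +
        E * (1 - E)\<^sup>2 * (\<epsilon>\<^sup>2 * (2 * \<sigma> * (u + v) - \<sigma>\<^sup>2 * \<epsilon>\<^sup>2 * u * v))"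
    proof -
      have "x - y = \<epsilon>\<^sup>2 * (u - v)" by (simp add: x_def y_def algebra_simps)
      then show ?thesis unfolding xy by algebra
    qed
    finally have phi: "qOU_phi q 0 (\<epsilon> * \<tau>) x y = (1 - E) ^ 4 + \<sigma>\<^sup>2 * E\<^sup>2 * (\<epsilon>\<^sup>2 * (u - v))\<^sup>2 +
        E * (1 - E)\<^sup>2 * (\<epsilon>\<^sup>2 * (2 * \<sigma> * (u + v) - \<sigma>\<^sup>2 * \<epsilon>\<^sup>2 * u * v))" .
    have "(a / \<epsilon>) ^ 4 + \<sigma>\<^sup>2 * E\<^sup>2 * d\<^sup>2 + (a / \<epsilon>)\<^sup>2 * E * w =
        (a ^ 4 + \<sigma>\<^sup>2 * E\<^sup>2 * (\<epsilon>\<^sup>2 * d)\<^sup>2 + E * a\<^sup>2 * (\<epsilon>\<^sup>2 * w)) / \<epsilon> ^ 4" for a d w :: real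
      using elim by (simp add: field_simps power2_eq_square power4_eq_xxxx)
    then show ?case
      unfolding E_def[symmetric] x_def[symmetric] y_def[symmetric] phi .
  qed
  ultimately show ?thesis
    by (auto dest: Lim_transform_eventually)
qed

text \<open>
  If \<open>u < 0\<close> or \<open>v < 0\<close>, the rescaled point lies outside the state space; if \<open>v = 0\<close>, it is the edge, where
  the density vanishes. In the remaining case the powers of \<open>\<epsilon>\<close> and of \<open>(q;q)\<^sub>\<infinity>\<close> are collected.
\<close>

lemma qOU_kernel_edge_limit:
  fixes q s t u v :: real
  assumes q: "\<bar>q\<bar> < 1" and st: "s < t"
  shows "((\<lambda>\<epsilon>. \<epsilon>\<^sup>2 * qOU_kernel q (\<epsilon> * s) (\<epsilon> * t)
      (- 2 / sqrt (1 - q) + \<epsilon>\<^sup>2 * u) (- 2 / sqrt (1 - q) + \<epsilon>\<^sup>2 * v))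
    \<longlongrightarrow> biane_kernel (sqrt (1 - q) / 4) s t u v) (at_right 0)"
proof -
  define \<sigma> where "\<sigma> = sqrt (1 - q)"
  have \<sigma>: "0 < \<sigma>" "1 - q = \<sigma>\<^sup>2" using q by (auto simp: \<sigma>_def)
  define \<tau> where "\<tau> = t - s"
  have \<tau>: "0 < \<tau>" using st by (simp add: \<tau>_def)
  let ?x = "\<lambda>\<epsilon>. - 2 / \<sigma> + \<epsilon>\<^sup>2 * u" and ?y = "\<lambda>\<epsilon>. - 2 / \<sigma> + \<epsilon>\<^sup>2 * v"
  show ?thesis
    unfolding \<sigma>_def[symmetric]
  proof (cases "0 \<le> u \<and> 0 < v")
    case False
    have "\<forall>\<^sub>F \<epsilon> in at_right 0. \<epsilon>\<^sup>2 * qOU_kernel q (\<epsilon> * s) (\<epsilon> * t) (?x \<epsilon>) (?y \<epsilon>) = 0"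
      using eventually_at_right_less[of 0]
    proof eventually_elim
      case (elim \<epsilon>)
      consider "u < 0" | "v < 0" | "v = 0" using False by linarith
      then show ?case
      proof cases
        case 1
        then have "?x \<epsilon> \<notin> qOU_states q"
          using elim by (simp add: qOU_states_def \<sigma>_def[symmetric] mult_pos_neg not_le)
        then show ?thesis by (simp add: qOU_kernel_def)
      next
        case 2
        then have "?y \<epsilon> \<notin> qOU_states q"
          using elim by (simp add: qOU_states_def \<sigma>_def[symmetric] mult_pos_neg not_le)
        then show ?thesis by (simp add: qOU_kernel_def qOU_transition_def qOU_density_def)
      next
        case 3
        then have "qOU_density q (?y \<epsilon>) = 0"
          unfolding qOU_density_def \<sigma>(2) using \<sigma>(1) by (simp add: power_divide)
        then show ?thesis by (simp add: qOU_kernel_def qOU_transition_def)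
      qed
    qed
    moreover have "biane_kernel (\<sigma> / 4) s t u v = 0"
      using False \<sigma>(1) by (intro biane_kernel_eq_0) auto
    ultimately show "((\<lambda>\<epsilon>. \<epsilon>\<^sup>2 * qOU_kernel q (\<epsilon> * s) (\<epsilon> * t) (?x \<epsilon>) (?y \<epsilon>))
        \<longlongrightarrow> biane_kernel (\<sigma> / 4) s t u v) (at_right 0)"
      by (simp add: tendsto_eventually)
  next
    case True
    then have u: "0 \<le> u" and v: "0 < v" by auto
    define P where "P = q_pochhammer q q"
    define D where "D = \<tau> ^ 4 + \<sigma>\<^sup>2 * (u - v)\<^sup>2 + \<tau>\<^sup>2 * (2 * \<sigma> * (u + v))"
    have P: "P \<noteq> 0" using q_pochhammer_pos[OF q q] by (simp add: P_def)
    have D: "D \<noteq> 0" using edge_denominator_pos[OF \<sigma>(1) \<tau> u v] by (simp add: D_def)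
    note lims = qOU_products_at_edge[OF q less_imp_le[OF \<tau>] u less_imp_le[OF v], folded \<sigma>_def P_def]
    have phi0: "((\<lambda>\<epsilon>. qOU_phi q 0 (\<epsilon> * \<tau>) (?x \<epsilon>) (?y \<epsilon>) / \<epsilon> ^ 4) \<longlongrightarrow> D) (at_right 0)"
      using qOU_phi_0_at_edge[of q \<tau> u v] q by (simp add: \<sigma>_def D_def)
    have exp0: "((\<lambda>\<epsilon>. (1 - exp (- 2 * (\<epsilon> * \<tau>))) / \<epsilon>) \<longlongrightarrow> 2 * \<tau>) (at_right 0)"
      by real_asymp
    have sqrt0: "((\<lambda>\<epsilon>. sqrt (4 * \<sigma> * v - \<sigma>\<^sup>2 * \<epsilon>\<^sup>2 * v\<^sup>2)) \<longlongrightarrow> sqrt (4 * \<sigma> * v - \<sigma>\<^sup>2 * 0\<^sup>2 * v\<^sup>2)) (at_right 0)"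
      by (intro tendsto_intros)
    let ?A = "\<lambda>\<epsilon>. \<Prod>k. 1 - exp (- 2 * (\<epsilon> * \<tau>)) * q ^ Suc k"
    let ?B = "\<lambda>\<epsilon>. \<Prod>k. qOU_phi q (Suc k) (\<epsilon> * \<tau>) (?x \<epsilon>) (?y \<epsilon>)"
    let ?C = "\<lambda>\<epsilon>. \<Prod>k. (1 + q ^ Suc k)\<^sup>2 - (1 - q) * (?y \<epsilon>)\<^sup>2 * q ^ Suc k"
    have "((\<lambda>\<epsilon>. ((1 - exp (- 2 * (\<epsilon> * \<tau>))) / \<epsilon>) * ?A \<epsilon> *
        (1 / (qOU_phi q 0 (\<epsilon> * \<tau>) (?x \<epsilon>) (?y \<epsilon>) / \<epsilon> ^ 4 * ?B \<epsilon>)) *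
        (\<sigma> * P / (2 * pi) * sqrt (4 * \<sigma> * v - \<sigma>\<^sup>2 * \<epsilon>\<^sup>2 * v\<^sup>2) * ?C \<epsilon>)) \<longlongrightarrow>
        2 * \<tau> * P * (1 / (D * P ^ 4)) * (\<sigma> * P / (2 * pi) * sqrt (4 * \<sigma> * v - \<sigma>\<^sup>2 * 0\<^sup>2 * v\<^sup>2) * P\<^sup>2)) (at_right 0)"
      using P D by (intro tendsto_mult tendsto_divide tendsto_const lims phi0 exp0 sqrt0) auto
    moreover have "\<forall>\<^sub>F \<epsilon> in at_right 0. ((1 - exp (- 2 * (\<epsilon> * \<tau>))) / \<epsilon>) * ?A \<epsilon> *
        (1 / (qOU_phi q 0 (\<epsilon> * \<tau>) (?x \<epsilon>) (?y \<epsilon>) / \<epsilon> ^ 4 * ?B \<epsilon>)) *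
        (\<sigma> * P / (2 * pi) * sqrt (4 * \<sigma> * v - \<sigma>\<^sup>2 * \<epsilon>\<^sup>2 * v\<^sup>2) * ?C \<epsilon>) =
        \<epsilon>\<^sup>2 * qOU_kernel q (\<epsilon> * s) (\<epsilon> * t) (?x \<epsilon>) (?y \<epsilon>)"
      using eventually_at_right_less[of 0] lims(4)
    proof eventually_elim
      case (elim \<epsilon>)
      then have \<epsilon>: "0 < \<epsilon>" and x: "?x \<epsilon> \<in> qOU_states q" and y: "?y \<epsilon> \<in> qOU_states q" by auto
      have "4 - (1 - q) * (?y \<epsilon>)\<^sup>2 = \<epsilon>\<^sup>2 * (4 * \<sigma> * v - \<sigma>\<^sup>2 * \<epsilon>\<^sup>2 * v\<^sup>2)"
        unfolding \<sigma>(2) using \<sigma>(1) by (simp add: field_simps power2_eq_square)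
      then have sq: "sqrt (4 - (1 - q) * (?y \<epsilon>)\<^sup>2) = \<epsilon> * sqrt (4 * \<sigma> * v - \<sigma>\<^sup>2 * \<epsilon>\<^sup>2 * v\<^sup>2)"
        using \<epsilon> by (simp add: real_sqrt_mult)
      have dens: "qOU_density q (?y \<epsilon>) =
          \<sigma> * P / (2 * pi) * (\<epsilon> * sqrt (4 * \<sigma> * v - \<sigma>\<^sup>2 * \<epsilon>\<^sup>2 * v\<^sup>2)) * ?C \<epsilon>"
        using y unfolding qOU_density_def sq by (simp only: if_True \<sigma>_def P_def)
      have diff: "\<epsilon> * t - \<epsilon> * s = \<epsilon> * \<tau>" by (simp add: \<tau>_def algebra_simps)
      have *: "qOU_kernel q (\<epsilon> * s) (\<epsilon> * t) (?x \<epsilon>) (?y \<epsilon>) = (1 - exp (- 2 * (\<epsilon> * \<tau>))) * ?A \<epsilon> *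
          (1 / (qOU_phi q 0 (\<epsilon> * \<tau>) (?x \<epsilon>) (?y \<epsilon>) * ?B \<epsilon>)) *
          (\<sigma> * P / (2 * pi) * (\<epsilon> * sqrt (4 * \<sigma> * v - \<sigma>\<^sup>2 * \<epsilon>\<^sup>2 * v\<^sup>2)) * ?C \<epsilon>)"
        using qOU_transition_split_first[OF q _ x y, of "\<epsilon> * s" "\<epsilon> * t"] st \<epsilon> x
        unfolding qOU_kernel_def dens diff by simp
      have "e / \<epsilon> * a * (1 / (f / \<epsilon> ^ 4 * b)) * (p * r * c) =
          \<epsilon>\<^sup>2 * (e * a * (1 / (f * b)) * (p * (\<epsilon> * r) * c))" for e a f b p r c :: real
        using \<epsilon> by (simp add: field_simps power2_eq_square power4_eq_xxxx)
      then show ?case unfolding * .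
    qed
    moreover have "2 * \<tau> * P * (1 / (D * P ^ 4)) * (\<sigma> * P / (2 * pi) * sqrt (4 * \<sigma> * v - \<sigma>\<^sup>2 * 0\<^sup>2 * v\<^sup>2) * P\<^sup>2) =
        biane_kernel (\<sigma> / 4) s t u v"
      unfolding biane_kernel_eq[OF \<sigma>(1) u v] \<tau>_def[symmetric] D_def[symmetric]
      using P D by (simp add: field_simps real_sqrt_mult power2_eq_square power4_eq_xxxx)
    ultimately show "((\<lambda>\<epsilon>. \<epsilon>\<^sup>2 * qOU_kernel q (\<epsilon> * s) (\<epsilon> * t) (?x \<epsilon>) (?y \<epsilon>))
        \<longlongrightarrow> biane_kernel (\<sigma> / 4) s t u v) (at_right 0)"
      by (auto dest: Lim_transform_eventually)
  qed
qed

section \<open>Finite-dimensional distributions\<close>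

lemma borel_measurable_vec_lambda:
  fixes g :: "'n::finite \<Rightarrow> 'a \<Rightarrow> real"
  assumes "\<And>i. g i \<in> borel_measurable M"
  shows "(\<lambda>x. \<chi> i. g i x) \<in> borel_measurable M"
proof -
  have "(\<lambda>x. (\<chi> i. g i x) \<bullet> b) \<in> borel_measurable M" if "b \<in> Basis" for b :: "real ^ 'n"
  proof -
    from that obtain i where "b = axis i 1" by (auto simp: Basis_vec_def)
    then show ?thesis using assms[of i] by (simp add: inner_axis)
  qed
  then show ?thesis by (subst borel_measurable_euclidean_space) auto
qed

text \<open>
  A time \<open>t i\<close> is the \<open>\<kappa> i\<close>-th one in an increasing enumeration; \<open>\<kappa> i = 0\<close> marks the times equal to \<open>0\<close>,
  at which the process sits at its starting point.
\<close>

lemma integral_fin_dim_distr: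
  fixes t :: "'n::finite \<Rightarrow> real" and V :: "nat \<Rightarrow> 'a \<Rightarrow> real" and \<kappa> :: "'n \<Rightarrow> nat"
  assumes f: "f \<in> borel_measurable borel"
    and Y: "\<And>i. Y (t i) \<in> borel_measurable M"
    and V: "\<And>k. k \<in> {0<..n} \<Longrightarrow> V k \<in> borel_measurable M"
    and \<kappa>: "\<And>i. \<kappa> i \<le> n"
    and eq: "\<And>i. AE \<omega> in M. Y (t i) \<omega> = (if \<kappa> i = 0 then 0 else V (\<kappa> i) \<omega>)"
  defines "F \<equiv> \<lambda>y. f (\<chi> i. if \<kappa> i = 0 then 0 else y (\<kappa> i))"
  shows "F \<in> borel_measurable (\<Pi>\<^sub>M k\<in>{0<..n}. lborel)"
    and "(\<integral>x. f x \<partial>fin_dim_distr M Y t) =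
      (\<integral>y. (F y :: real) \<partial>distr M (\<Pi>\<^sub>M k\<in>{0<..n}. lborel) (\<lambda>\<omega>. \<lambda>k\<in>{0<..n}. V k \<omega>))"
proof -
  have "(\<lambda>y. if \<kappa> i = 0 then 0 else y (\<kappa> i)) \<in> borel_measurable (\<Pi>\<^sub>M k\<in>{0<..n}. (lborel :: real measure))" for i
  proof (cases "\<kappa> i = 0")
    case False
    then show ?thesis
      using measurable_component_singleton[of "\<kappa> i" "{0<..n}" "\<lambda>_. lborel :: real measure"] \<kappa>[of i]
      by (simp cong: measurable_cong_sets)
  qed simp
  then show F: "F \<in> borel_measurable (\<Pi>\<^sub>M k\<in>{0<..n}. lborel)"
    unfolding F_def by (intro measurable_compose[OF borel_measurable_vec_lambda f])
  have VP: "(\<lambda>\<omega>. \<lambda>k\<in>{0<..n}. V k \<omega>) \<in> measurable M (\<Pi>\<^sub>M k\<in>{0<..n}. lborel)"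
    using V by (intro measurable_restrict) simp
  have YM: "(\<lambda>\<omega>. \<chi> i. Y (t i) \<omega>) \<in> borel_measurable M"
    by (rule borel_measurable_vec_lambda[OF Y])
  have "AE \<omega> in M. \<forall>i\<in>UNIV. Y (t i) \<omega> = (if \<kappa> i = 0 then 0 else V (\<kappa> i) \<omega>)"
    using eq by (intro AE_finite_allI) auto
  then have ae: "AE \<omega> in M. f (\<chi> i. Y (t i) \<omega>) = F (\<lambda>k\<in>{0<..n}. V k \<omega>)"
  proof eventually_elim
    case (elim \<omega>)
    then have "(\<chi> i. Y (t i) \<omega>) = (\<chi> i. if \<kappa> i = 0 then 0 else (\<lambda>k\<in>{0<..n}. V k \<omega>) (\<kappa> i))"
      using \<kappa> by (simp add: vec_eq_iff)
    then show ?case by (simp add: F_def)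
  qed
  have "(\<integral>x. f x \<partial>fin_dim_distr M Y t) = (\<integral>\<omega>. f (\<chi> i. Y (t i) \<omega>) \<partial>M)"
    unfolding fin_dim_distr_def by (rule integral_distr[OF YM f])
  also have "\<dots> = (\<integral>\<omega>. F (\<lambda>k\<in>{0<..n}. V k \<omega>) \<partial>M)"
    by (rule integral_cong_AE) (use ae measurable_compose[OF YM f] measurable_compose[OF VP F] in auto)
  also have "\<dots> = (\<integral>y. F y \<partial>distr M (\<Pi>\<^sub>M k\<in>{0<..n}. lborel) (\<lambda>\<omega>. \<lambda>k\<in>{0<..n}. V k \<omega>))"
    by (rule integral_distr[OF VP F, symmetric])
  finally show "(\<integral>x. f x \<partial>fin_dim_distr M Y t) =
      (\<integral>y. F y \<partial>distr M (\<Pi>\<^sub>M k\<in>{0<..n}. lborel) (\<lambda>\<omega>. \<lambda>k\<in>{0<..n}. V k \<omega>))" .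
qed

text \<open>
  The given times may be unordered, repeated, or zero, whereas joint densities need strictly
  increasing times after the starting time \<open>0\<close>.
\<close>

lemma ordered_times:
  fixes t :: "'n::finite \<Rightarrow> real"
  assumes "\<And>i. 0 \<le> t i"
  obtains n :: nat and \<sigma> :: "nat \<Rightarrow> real" and \<kappa> :: "'n \<Rightarrow> nat"
  where "\<sigma> 0 = 0" "\<And>k. k < n \<Longrightarrow> \<sigma> k < \<sigma> (Suc k)" "\<And>i. \<kappa> i \<le> n" "\<And>i. t i = \<sigma> (\<kappa> i)"
proof -
  define T where "T = insert 0 (range t)"
  define l where "l = sorted_list_of_set T"
  have T: "finite T" "T \<noteq> {}" by (auto simp: T_def)
  have l: "sorted_wrt (<) l" "set l = T" using T by (auto simp: l_def)
  have ne: "l \<noteq> []" using l(2) T by auto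
  have "\<exists>k<length l. t i = l ! k" for i
    using l(2) by (metis T_def in_set_conv_nth insertCI rangeI)
  then obtain \<kappa> where \<kappa>: "\<And>i. \<kappa> i < length l" "\<And>i. t i = l ! \<kappa> i" by metis
  have "l ! 0 = 0"
  proof -
    obtain k where k: "k < length l" "l ! k = 0"
      using l(2) by (metis T_def in_set_conv_nth insertI1)
    have "l ! 0 \<in> T" using l(2) ne by (metis length_greater_0_conv nth_mem)
    then have "0 \<le> l ! 0" using assms by (auto simp: T_def)
    then show ?thesis
      using k sorted_wrt_nth_less[OF l(1), of 0 k] by (cases "k = 0") auto
  qed
  moreover have "l ! k < l ! Suc k" if "k < length l - 1" for k
    using sorted_wrt_nth_less[OF l(1), of k "Suc k"] that by simp
  moreover have "\<kappa> i \<le> length l - 1" for i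
    using \<kappa>(1)[of i] by linarith
  ultimately show ?thesis
    using that[of "(!) l" "length l - 1" \<kappa>] \<kappa>(2) by blast
qed

theorem proposition2p2:
  fixes q :: real
    and M :: "'a measure" and X :: "real \<Rightarrow> 'a \<Rightarrow> real"
    and N :: "'b measure" and Z :: "real \<Rightarrow> 'b \<Rightarrow> real"
    and t :: "'n::finite \<Rightarrow> real"
  assumes "- 1 < q" "q < 1"
    and "qOU_process q M (- 2 / sqrt (1 - q)) X"
    and "biane_process N Z"
    and "\<And>i. 0 \<le> t i"
  shows "converges_weakly
           (\<lambda>\<epsilon>. fin_dim_distr M (\<lambda>s \<omega>. (X (\<epsilon> * s) \<omega> - X 0 \<omega>) / \<epsilon>\<^sup>2) t)
           (fin_dim_distr N (\<lambda>s \<omega>. 4 / sqrt (1 - q) * (Z s \<omega> - s\<^sup>2 / 4)) t)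
           (at_right 0)"
  unfolding converges_weakly_def
proof (intro allI impI)
  fix f :: "real ^ 'n \<Rightarrow> real"
  assume "continuous_on UNIV f" and bdd: "bounded (range f)"
  then have f: "f \<in> borel_measurable borel" by (simp add: borel_measurable_continuous_onI)
  obtain C where C: "\<And>x. \<bar>f x\<bar> \<le> C"
    using bdd by (auto simp: bounded_iff)
  have q: "\<bar>q\<bar> < 1" using assms by auto
  define \<rho> where "\<rho> = sqrt (1 - q)"
  have \<rho>: "0 < \<rho>" using assms by (simp add: \<rho>_def)
  note mX = assms(3)[unfolded qOU_process_def, THEN conjunct1]
  note mZ = assms(4)[unfolded biane_process_def]
  obtain n :: nat and \<sigma> :: "nat \<Rightarrow> real" and \<kappa> :: "'n \<Rightarrow> nat"
    where \<sigma>: "\<sigma> 0 = 0" "\<And>k. k < n \<Longrightarrow> \<sigma> k < \<sigma> (Suc k)"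
      and \<kappa>: "\<And>i. \<kappa> i \<le> n" "\<And>i. t i = \<sigma> (\<kappa> i)"
    by (rule ordered_times[of t, OF assms(5)]) blast
  have \<sigma>_nonneg: "0 \<le> \<sigma> k" if "k \<le> n" for k
    using that
  proof (induction k)
    case (Suc k)
    then show ?case using \<sigma>(2)[of k] by linarith
  qed (simp add: \<sigma>(1))
  let ?L = "\<Pi>\<^sub>M k\<in>{0<..n}. (lborel :: real measure)"
  \<comment> \<open>The test function, read as a function of the process at the increasing times.\<close>
  define F where "F y = f (\<chi> i. if \<kappa> i = 0 then 0 else y (\<kappa> i))" for y :: "nat \<Rightarrow> real"
  define gX where "gX \<epsilon> k u v = \<epsilon>\<^sup>2 * qOU_kernel q (\<epsilon> * \<sigma> k) (\<epsilon> * \<sigma> (Suc k))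
      (- 2 / \<rho> + \<epsilon>\<^sup>2 * u) (- 2 / \<rho> + \<epsilon>\<^sup>2 * v)" for \<epsilon> k u v
  define gZ where "gZ k u v = biane_kernel (\<rho> / 4) (\<sigma> k) (\<sigma> (Suc k)) u v" for k u v
  define VX where "VX \<epsilon> k \<omega> = (X (\<epsilon> * \<sigma> k) \<omega> - - 2 / \<rho>) / \<epsilon>\<^sup>2" for \<epsilon> k \<omega>
  define VZ where "VZ k \<omega> = (Z (\<sigma> k) \<omega> - (\<sigma> k)\<^sup>2 / 4) / (\<rho> / 4)" for k \<omega>

  note X = markov_processD(2)[OF mX] markov_processD(2)[OF mZ]
  have XZ0: "AE \<omega> in M. X 0 \<omega> = - 2 / \<rho>" "AE \<omega> in N. Z 0 \<omega> = 0"
    using markov_processD(3)[OF mX] markov_processD(3)[OF mZ] by (simp_all add: \<rho>_def)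
  note prob = markov_processD(1)[OF mX] markov_processD(1)[OF mZ]

  have VX: "VX \<epsilon> k \<in> borel_measurable M" if "0 < \<epsilon>" "k \<le> n" for \<epsilon> k
  proof -
    have [measurable]: "X (\<epsilon> * \<sigma> k) \<in> borel_measurable M" using \<sigma>_nonneg that by (intro X) simp
    show ?thesis unfolding VX_def by measurable
  qed
  have VZ: "VZ k \<in> borel_measurable N" if "k \<le> n" for k
  proof -
    have [measurable]: "Z (\<sigma> k) \<in> borel_measurable N" using \<sigma>_nonneg that by (intro X)
    show ?thesis unfolding VZ_def by measurable
  qed

  have gX_meas: "(\<lambda>(u, v). gX \<epsilon> k u v) \<in> borel_measurable (borel \<Otimes>\<^sub>M borel)"
    and gX_nonneg: "0 \<le> gX \<epsilon> k u v" if "0 < \<epsilon>" "k < n" for \<epsilon> k u v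
  proof -
    have *: "\<epsilon> * \<sigma> k < \<epsilon> * \<sigma> (Suc k)" using that \<sigma>(2) by simp
    have "(\<lambda>z. (- 2 / \<rho> + \<epsilon>\<^sup>2 * fst z, - 2 / \<rho> + \<epsilon>\<^sup>2 * snd z)) \<in> measurable (borel \<Otimes>\<^sub>M borel) (borel \<Otimes>\<^sub>M borel)"
      by measurable
    from measurable_compose[OF this qOU_kernel_measurable[OF q *]]
    show "(\<lambda>(u, v). gX \<epsilon> k u v) \<in> borel_measurable (borel \<Otimes>\<^sub>M borel)"
      unfolding gX_def by (simp add: case_prod_beta)
    show "0 \<le> gX \<epsilon> k u v"
      unfolding gX_def using qOU_kernel_nonneg[OF q *] by simp
  qed
  have gZ_meas: "(\<lambda>(u, v). gZ k u v) \<in> borel_measurable (borel \<Otimes>\<^sub>M borel)" for k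
    unfolding gZ_def by (rule biane_kernel_measurable)
  have gZ_nonneg: "0 \<le> gZ k u v" if "k < n" for k u v
    unfolding gZ_def using biane_kernel_nonneg[OF \<rho>] \<sigma>(2)[OF that] by simp

  have dX: "distr M ?L (\<lambda>\<omega>. \<lambda>k\<in>{0<..n}. VX \<epsilon> k \<omega>) = density ?L (\<lambda>y. ennreal (chain_density (gX \<epsilon>) n y))"
    if "0 < \<epsilon>" for \<epsilon>
    unfolding VX_def
  proof (rule markov_process_distr_affine[OF mX])
    show "gX \<epsilon> k u v = \<epsilon>\<^sup>2 * qOU_transition q (\<epsilon> * \<sigma> k) (\<epsilon> * \<sigma> (Suc k))
        (- 2 / \<rho> + \<epsilon>\<^sup>2 * u) (- 2 / \<rho> + \<epsilon>\<^sup>2 * v)"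
      if "- 2 / \<rho> + \<epsilon>\<^sup>2 * u \<in> qOU_states q" for k u v
      using that by (simp add: gX_def qOU_kernel_def)
    show "\<epsilon> * \<sigma> 0 = 0" "0 < \<epsilon>\<^sup>2" "- 2 / \<rho> = - 2 / sqrt (1 - q)"
      using that \<sigma>(1) by (simp_all add: \<rho>_def)
    show "\<epsilon> * \<sigma> k < \<epsilon> * \<sigma> (Suc k)" if "k < n" for k
      using \<sigma>(2)[OF that] \<open>0 < \<epsilon>\<close> by simp
    show "(\<lambda>(u, v). gX \<epsilon> k u v) \<in> borel_measurable (borel \<Otimes>\<^sub>M borel)" if "k < n" for k
      by (rule gX_meas[OF \<open>0 < \<epsilon>\<close> that])
    show "0 \<le> gX \<epsilon> k u v" if "k < n" for k u v
      by (rule gX_nonneg[OF \<open>0 < \<epsilon>\<close> that])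
  qed
  have dZ: "distr N ?L (\<lambda>\<omega>. \<lambda>k\<in>{0<..n}. VZ k \<omega>) = density ?L (\<lambda>y. ennreal (chain_density gZ n y))"
    unfolding VZ_def
  proof (rule markov_process_distr_affine[OF mZ])
    show "gZ k u v = \<rho> / 4 * biane_transition (\<sigma> k) (\<sigma> (Suc k))
        ((\<sigma> k)\<^sup>2 / 4 + \<rho> / 4 * u) ((\<sigma> (Suc k))\<^sup>2 / 4 + \<rho> / 4 * v)"
      if "(\<sigma> k)\<^sup>2 / 4 + \<rho> / 4 * u \<in> {(\<sigma> k)\<^sup>2 / 4..}" for k u v
      using that \<rho> by (simp add: gZ_def biane_kernel_def zero_le_mult_iff)
    show "(\<sigma> 0)\<^sup>2 / 4 = 0" "0 < \<rho> / 4"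
      using \<sigma>(1) \<rho> by simp_all
    show "\<sigma> 0 = 0" "\<And>k. k < n \<Longrightarrow> \<sigma> k < \<sigma> (Suc k)" by fact+
    show "(\<lambda>(u, v). gZ k u v) \<in> borel_measurable (borel \<Otimes>\<^sub>M borel)" for k
      by (rule gZ_meas)
    show "0 \<le> gZ k u v" if "k < n" for k u v
      by (rule gZ_nonneg[OF that])
  qed

  have fX: "(\<integral>x. f x \<partial>fin_dim_distr M (\<lambda>s \<omega>. (X (\<epsilon> * s) \<omega> - X 0 \<omega>) / \<epsilon>\<^sup>2) t) =
      (\<integral>y. F y \<partial>density ?L (\<lambda>y. ennreal (chain_density (gX \<epsilon>) n y)))" if "0 < \<epsilon>" for \<epsilon>
    unfolding dX[OF that, symmetric] F_def
  proof (rule integral_fin_dim_distr(2)[OF f _ _ \<kappa>(1)])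
    show "(\<lambda>\<omega>. (X (\<epsilon> * t i) \<omega> - X 0 \<omega>) / \<epsilon>\<^sup>2) \<in> borel_measurable M" for i
    proof -
      have [measurable]: "X (\<epsilon> * t i) \<in> borel_measurable M" "X 0 \<in> borel_measurable M"
        using assms(5)[of i] that by (auto intro!: X)
      show ?thesis by measurable
    qed
    show "AE \<omega> in M. (X (\<epsilon> * t i) \<omega> - X 0 \<omega>) / \<epsilon>\<^sup>2 = (if \<kappa> i = 0 then 0 else VX \<epsilon> (\<kappa> i) \<omega>)" for i
      using XZ0(1) by eventually_elim (auto simp: VX_def \<kappa>(2) \<sigma>(1))
    show "VX \<epsilon> k \<in> borel_measurable M" if "k \<in> {0<..n}" for k
      using VX[OF \<open>0 < \<epsilon>\<close>, of k] that by simp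
  qed
  have fZ: "(\<integral>x. f x \<partial>fin_dim_distr N (\<lambda>s \<omega>. 4 / \<rho> * (Z s \<omega> - s\<^sup>2 / 4)) t) =
      (\<integral>y. F y \<partial>density ?L (\<lambda>y. ennreal (chain_density gZ n y)))"
    and F_meas: "F \<in> borel_measurable ?L"
  proof -
    have 1: "(\<lambda>\<omega>. 4 / \<rho> * (Z (t i) \<omega> - (t i)\<^sup>2 / 4)) \<in> borel_measurable N" for i
    proof -
      have [measurable]: "Z (t i) \<in> borel_measurable N" using assms(5)[of i] by (intro X)
      show ?thesis by measurable
    qed
    have 2: "AE \<omega> in N. 4 / \<rho> * (Z (t i) \<omega> - (t i)\<^sup>2 / 4) = (if \<kappa> i = 0 then 0 else VZ (\<kappa> i) \<omega>)" for i
      using XZ0(2) by eventually_elim (auto simp: VZ_def \<kappa>(2) \<sigma>(1))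
    have 3: "VZ k \<in> borel_measurable N" if "k \<in> {0<..n}" for k using VZ that by auto
    show "(\<integral>x. f x \<partial>fin_dim_distr N (\<lambda>s \<omega>. 4 / \<rho> * (Z s \<omega> - s\<^sup>2 / 4)) t) =
      (\<integral>y. F y \<partial>density ?L (\<lambda>y. ennreal (chain_density gZ n y)))"
      unfolding dZ[symmetric] F_def by (rule integral_fin_dim_distr(2)[where Y="\<lambda>s \<omega>. 4 / \<rho> * (Z s \<omega> - s\<^sup>2 / 4)" and t=t, OF f 1 3 \<kappa>(1) 2])
    show "F \<in> borel_measurable ?L"
      unfolding F_def by (rule integral_fin_dim_distr(1)[where Y="\<lambda>s \<omega>. 4 / \<rho> * (Z s \<omega> - s\<^sup>2 / 4)" and t=t, OF f 1 3 \<kappa>(1) 2])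
  qed

  show "((\<lambda>\<epsilon>. \<integral>x. f x \<partial>fin_dim_distr M (\<lambda>s \<omega>. (X (\<epsilon> * s) \<omega> - X 0 \<omega>) / \<epsilon>\<^sup>2) t) \<longlongrightarrow>
      (\<integral>x. f x \<partial>fin_dim_distr N (\<lambda>s \<omega>. 4 / sqrt (1 - q) * (Z s \<omega> - s\<^sup>2 / 4)) t)) (at_right 0)"
    unfolding \<rho>_def[symmetric] fZ
  proof (rule tendsto_at_right_sequentially[of 0 1])
    fix e :: "nat \<Rightarrow> real"
    assume e: "\<And>k. 0 < e k" "e \<longlonglongrightarrow> 0"
    have "\<forall>\<^sub>F k in sequentially. e k \<in> {0<..} \<and> e k \<noteq> 0"
    proof (intro always_eventually allI)
      fix k show "e k \<in> {0<..} \<and> e k \<noteq> 0" using e(1)[of k] by simp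
    qed
    then have e0: "filterlim e (at_right 0) sequentially"
      using e(2) by (simp add: filterlim_at)
    have "(\<lambda>k. \<integral>y. F y \<partial>density ?L (\<lambda>y. ennreal (chain_density (gX (e k)) n y)))
        \<longlonglongrightarrow> (\<integral>y. F y \<partial>density ?L (\<lambda>y. ennreal (chain_density gZ n y)))"
    proof (rule integral_density_tendsto[OF _ _ _ _ _ _ _ F_meas])
      show "prob_space (density ?L (\<lambda>y. ennreal (chain_density (gX (e k)) n y)))" for k
        unfolding dX[OF e(1), symmetric]
        by (intro prob_space.prob_space_distr prob measurable_restrict) (simp add: VX[OF e(1)])
      show "prob_space (density ?L (\<lambda>y. ennreal (chain_density gZ n y)))"
        unfolding dZ[symmetric]
        by (intro prob_space.prob_space_distr prob measurable_restrict) (simp add: VZ)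
      show "(\<lambda>k. chain_density (gX (e k)) n y) \<longlonglongrightarrow> chain_density gZ n y" for y
        unfolding chain_density_def
      proof (rule tendsto_prod)
        fix i assume "i \<in> {..<n}"
        then have "\<sigma> i < \<sigma> (Suc i)" using \<sigma>(2) by simp
        from filterlim_compose[OF qOU_kernel_edge_limit[OF q this] e0]
        show "(\<lambda>k. gX (e k) i ((y(0 := 0)) i) (y (Suc i))) \<longlonglongrightarrow> gZ i ((y(0 := 0)) i) (y (Suc i))"
          unfolding gX_def gZ_def \<rho>_def .
      qed
      show "\<bar>F y\<bar> \<le> C" for y by (simp add: F_def C)
      show "chain_density (gX (e k)) n \<in> borel_measurable ?L" "0 \<le> chain_density (gX (e k)) n y" for k y
        using gX_meas[OF e(1)] gX_nonneg[OF e(1)]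
        by (intro chain_density_measurable chain_density_nonneg; blast)+
      show "chain_density gZ n \<in> borel_measurable ?L" "0 \<le> chain_density gZ n y" for y
        using gZ_meas gZ_nonneg
        by (intro chain_density_measurable chain_density_nonneg; blast)+
    qed
    then show "(\<lambda>k. \<integral>x. f x \<partial>fin_dim_distr M (\<lambda>s \<omega>. (X (e k * s) \<omega> - X 0 \<omega>) / (e k)\<^sup>2) t)
        \<longlonglongrightarrow> (\<integral>y. F y \<partial>density ?L (\<lambda>y. ennreal (chain_density gZ n y)))"
      by (simp only: fX[OF e(1)])
  qed simp
qed

end
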